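(* Let $T\subset\mathbb{R}^d$ ($d\in\{2,3\}$) be a nondegenerate simplex and $k\ge1$. The set of linear functionals $\Phi(T)$ is unisolvent on $\Sigma_k(T)$ (so $(T,\Sigma_k(T),\Phi(T))$ is a finite element in the sense of Ciarlet: the only $\tau\in\Sigma_k(T)$ with $\phi(\tau)=0$ for all $\phi\in\Phi(T)$ is $\tau=0$, and the number of functionals equals $\dim\Sigma_k(T)$), and $$\dim\Sigma_k(T)=\begin{cases}\frac32(k+1)(k+2)-3,& d=2,\\ \frac86(k+1)(k+2)(k+3)-8(k+1),& d=3.\end{cases}$$
   Context: $\mathbb{D}=\{M\in\mathbb{R}^{d\times d}:\operatorname{tr}M=0\}$. For a facet $F$ with unit normal $n$ and a matrix field $\tau$, $\tau_{nt}=\tau n-(n^T\tau n)n$, a tangential vector field on $F$ identified with an $\mathbb{R}^{d-1}$-valued function. $\Sigma_k(T)=\{\tau\in\mathbb{P}^k(T,\mathbb{D}):\tau_{nt}|_F\in\mathbb{P}^{k-1}(F,\mathbb{R}^{d-1})\text{ for all facets }F\text{ of }T\}$ and $\mathcal{B}_k(T)=\{\tau\in\Sigma_k(T):\tau_{nt}=0\text{ on }\partial T\}$. Let $\hat T$ be the unit reference simplex, $\phi_T:\hat T\to T$ an affine bijection and $F_T=\phi_T'$ its (constant) Jacobian. The degrees of freedom are $\Phi(T)=\Phi^T\cup\bigcup_{F}\Phi^F$, where for each facet $F$ of $T$, $\Phi^F=\{\tau\mapsto\int_F\tau_{nt}\cdot r\,ds:\ r\in\mathbb{P}^{k-1}(F,\mathbb{R}^{d-1})\}$,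 and $\Phi^T=\{\tau\mapsto\int_T\tau:F_T(\hat\eta\circ\phi_T^{-1})F_T^{-1}\,dx:\ \hat\eta\in\mathcal{B}_k(\hat T)\}$. *)

theory Defs
  imports "HOL-Analysis.Analysis" "HOL-Library.Function_Algebras"
begin

definition polyfun :: "nat \<Rightarrow> (real^'d \<Rightarrow> real) \<Rightarrow> bool" where
  "polyfun k f \<longleftrightarrow> (\<exists>c :: ('d \<Rightarrow> nat) \<Rightarrow> real.
     \<forall>x. f x = (\<Sum>\<alpha>\<in>{\<alpha>::'d \<Rightarrow> nat. sum \<alpha> UNIV \<le> k}. c \<alpha> * (\<Prod>i\<in>UNIV. (x $ i) ^ \<alpha> i)))"

definition polyvec :: "nat \<Rightarrow> (real^'d \<Rightarrow> real^'d) \<Rightarrow> bool" where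
  "polyvec k r \<longleftrightarrow> (\<forall>i. polyfun k (\<lambda>x. r x $ i))"

definition polymat :: "nat \<Rightarrow> (real^'d \<Rightarrow> real^'d^'d) \<Rightarrow> bool" where
  "polymat k \<tau> \<longleftrightarrow> (\<forall>i j. polyfun k (\<lambda>x. \<tau> x $ i $ j))"

definition fdim :: "('a \<Rightarrow> 'b::real_vector) set \<Rightarrow> nat" where
  "fdim S = vector_space.dim (\<lambda>(c::real) f x. c *\<^sub>R f x) S"

definition nondeg_simplex :: "(real^'d) set \<Rightarrow> bool" where
  "nondeg_simplex V \<longleftrightarrow> finite V \<and> card V = CARD('d) + 1 \<and> \<not> affine_dependent V"

definition ref_vertices :: "(real^'d) set" where
  "ref_vertices = insert 0 (range (\<lambda>i. axis i 1))"

definition facet_normal :: "(real^'d) set \<Rightarrow> real^'d" where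
  "facet_normal W = (SOME n. norm n = 1 \<and> (\<forall>x\<in>W. \<forall>y\<in>W. n \<bullet> (x - y) = 0))"

definition nt :: "(real^'d \<Rightarrow> real^'d^'d) \<Rightarrow> real^'d \<Rightarrow> real^'d \<Rightarrow> real^'d" where
  "nt \<tau> n x = \<tau> x *v n - (n \<bullet> (\<tau> x *v n)) *\<^sub>R n"

definition frob :: "real^'d^'d \<Rightarrow> real^'d^'d \<Rightarrow> real" where
  "frob M N = (\<Sum>i\<in>UNIV. \<Sum>j\<in>UNIV. M $ i $ j * N $ i $ j)"

(* surface integral over the (d-1)-simplex with vertex set W (card W = CARD('e) + 1),
   via an affine parametrisation from the reference (d-1)-simplex in R^('e),
   with surface element sqrt(det(J^T J)). *)
definition ref_simplex :: "(real^'e) set" where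
  "ref_simplex = {s. (\<forall>i. 0 \<le> s $ i) \<and> sum (\<lambda>i. s $ i) UNIV \<le> 1}"

definition facet_integral ::
  "'e::finite itself \<Rightarrow> (real^'d) set \<Rightarrow> (real^'d \<Rightarrow> real) \<Rightarrow> real" where
  "facet_integral E W g = (SOME I. \<exists>w0 (p :: 'e \<Rightarrow> real^'d).
      w0 \<in> W \<and> inj p \<and> w0 \<notin> range p \<and> W = insert w0 (range p) \<and>
      (let J = (\<chi> i j. (p j - w0) $ i) :: real^'e^'d in
       I = integral (ref_simplex :: (real^'e) set)
             (\<lambda>s. g (w0 + J *v s) * sqrt (det (transpose J ** J)))))"

definition Sigma_k :: "nat \<Rightarrow> (real^'d) set \<Rightarrow> (real^'d \<Rightarrow> real^'d^'d) set" where
  "Sigma_k k V = {\<tau>. polymat k \<tau> \<and> (\<forall>x. trace (\<tau> x) = 0) \<and>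
     (\<forall>w\<in>V. \<exists>p. polyvec (k - 1) p \<and>
        (\<forall>x\<in>convex hull (V - {w}). nt \<tau> (facet_normal (V - {w})) x = p x))}"

definition Bub :: "nat \<Rightarrow> (real^'d) set \<Rightarrow> (real^'d \<Rightarrow> real^'d^'d) set" where
  "Bub k V = {\<tau>\<in>Sigma_k k V. \<forall>w\<in>V. \<forall>x\<in>convex hull (V - {w}).
      nt \<tau> (facet_normal (V - {w})) x = 0}"

(* P^{k-1}(F, R^{d-1}): tangential polynomial fields of degree \<le> k-1 on the facet F
   (restricted to F, i.e. identified as functions on F) *)
definition facet_tests :: "nat \<Rightarrow> (real^'d) set \<Rightarrow> (real^'d \<Rightarrow> real^'d) set" where
  "facet_tests k W = {(\<lambda>x. if x \<in> convex hull W then r x else 0) | r.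
      polyvec (k - 1) r \<and> (\<forall>x\<in>convex hull W. r x \<bullet> facet_normal W = 0)}"

definition Phi_facet :: "'e::finite itself \<Rightarrow> nat \<Rightarrow> (real^'d) set \<Rightarrow>
    ((real^'d \<Rightarrow> real^'d^'d) \<Rightarrow> real) set" where
  "Phi_facet E k W = {(\<lambda>\<tau>. facet_integral E W (\<lambda>x. nt \<tau> (facet_normal W) x \<bullet> r x)) | r.
      r \<in> facet_tests k W}"

(* Phi^T, with phi_T x = A x + b *)
definition Phi_int :: "nat \<Rightarrow> (real^'d) set \<Rightarrow> real^'d^'d \<Rightarrow> real^'d \<Rightarrow>
    ((real^'d \<Rightarrow> real^'d^'d) \<Rightarrow> real) set" where
  "Phi_int k V A b = {(\<lambda>\<tau>. integral (convex hull V)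
      (\<lambda>x. frob (\<tau> x) (A ** \<eta> (matrix_inv A *v (x - b)) ** matrix_inv A))) | \<eta>.
      \<eta> \<in> Bub k ref_vertices}"

definition Phi :: "'e::finite itself \<Rightarrow> nat \<Rightarrow> (real^'d) set \<Rightarrow> real^'d^'d \<Rightarrow> real^'d \<Rightarrow>
    ((real^'d \<Rightarrow> real^'d^'d) \<Rightarrow> real) set" where
  "Phi E k V A b = Phi_int k V A b \<union> (\<Union>w\<in>V. Phi_facet E k (V - {w}))"

(* number of degrees of freedom: dimensions of the parameter spaces *)
definition num_dofs :: "nat \<Rightarrow> (real^'d) set \<Rightarrow> nat" where
  "num_dofs k V = fdim (Bub k (ref_vertices :: (real^'d) set)) + (\<Sum>w\<in>V. fdim (facet_tests k (V - {w})))"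

end

theory Submission
  imports Defs "HOL-Computational_Algebra.Polynomial"
begin

text \<open>
  For vertices \<open>v\<close> with barycentric coordinates of gradient \<open>g\<^sub>v\<close>, the facet opposite \<open>w\<close> has normal
  direction \<open>g\<^sub>w\<close>. The matrices \<open>g\<^sub>v (v - w)\<^sup>T - g\<^sub>u (u - w)\<^sup>T\<close>, with one vertex \<open>u = u(w)\<close> fixed
  for each \<open>w\<close>, are traceless and have eigenvectors \<open>g\<^sub>z\<close> for all \<open>z \<noteq> w\<close>, so their normal-tangential
  trace lives on the facet opposite \<open>w\<close> only. There are \<open>(d + 1)(d - 1) = d\<^sup>2 - 1\<close> of them and they
  form a basis of the traceless matrices. In this basis all trace conditions decouple: the
  coefficient of a basis matrix belonging to \<open>w\<close> has, on that facet, degree at most \<open>k - 1\<close>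
  (resp. vanishes for bubbles). The scalar dimensions then follow from rank-nullity for the
  restriction to a hyperplane. Unisolvence: the facet functionals force a vanishing trace, and
  pulling back by \<open>\<tau> \<mapsto> A\<^sup>T (\<tau> \<circ> \<phi>) A\<^sup>-\<^sup>T\<close> gives a reference bubble whose interior functional is the
  squared norm of that pullback. All this works in every dimension.
\<close>

section \<open>Dimensions in function spaces\<close>

text \<open>Fields and tests are functions on the whole space, while the side conditions concern
  compact facets. A polynomial that vanishes on a facet vanishes on its hyperplane and is a multiple
  of an affine equation of it. So a coefficient belonging to w is l q + p, where l is the
  barycentric coordinate of w, q has degree at most k - 1, and p is zero for bubbles and of degree
  at most k - 1 for \<open>Sigma_k\<close>. Each basis matrix thus carries a bubble part, matched by
  interior tests, and a facet part, matched by the d - 1 tangential components of the tests on d + 1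
  facets; the counts agree term by term.

  Differences of two rank-one matrices occur because a single
  \<open>g\<^sub>v (v - w)\<^sup>T\<close> has trace 1.

  The pull-back of the overview has two roles at once. It is the Frobenius adjoint of the
  transformation inside the interior functionals, which produces the squared norm. It is also
  compatible with gradients, which transform by the inverse transpose of A, and so preserves the
  eigenvector condition that characterises a vanishing trace.\<close>

interpretation FV: vector_space "\<lambda>(c::real) (f::'a \<Rightarrow> 'b::real_vector) x. c *\<^sub>R f x"
  by unfold_locales (auto simp: fun_eq_iff algebra_simps)

text \<open>The number \<open>fdim\<close> cannot tell an infinite-dimensional space from a trivial
  one and depends only on the span. This relation also certifies that \<open>S\<close> is a subspace
  with a finite basis, so that dimensions can be added by rank-nullity.\<close>

definition hasdim :: "('a \<Rightarrow> 'b::real_vector) set \<Rightarrow> nat \<Rightarrow> bool" where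
  "hasdim S n \<longleftrightarrow> (\<exists>B. finite B \<and> card B = n \<and> FV.independent B \<and> FV.span B = S)"

lemma fdim_eq_if_hasdim: "hasdim S n \<Longrightarrow> fdim S = n"
  unfolding hasdim_def fdim_def using FV.dim_eq_card FV.span_span by metis

definition flinear :: "(('a \<Rightarrow> 'b::real_vector) \<Rightarrow> ('c \<Rightarrow> 'e::real_vector)) \<Rightarrow> bool" where
  "flinear f \<longleftrightarrow> (\<forall>x y. f (x + y) = f x + f y) \<and> (\<forall>c x. f (\<lambda>t. c *\<^sub>R x t) = (\<lambda>t. c *\<^sub>R f x t))"

lemma flinear_add: "flinear f \<Longrightarrow> f (x + y) = f x + f y"
  and flinear_scale: "flinear f \<Longrightarrow> f (\<lambda>t. c *\<^sub>R x t) = (\<lambda>t. c *\<^sub>R f x t)"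
  by (auto simp: flinear_def)

lemma flinear_zero: "flinear f \<Longrightarrow> f 0 = 0"
  using flinear_scale[of f 0 0] by (simp add: zero_fun_def)

lemma flinear_diff: "flinear f \<Longrightarrow> f (x - y) = f x - f y"
  using flinear_add[of f "x - y" y] by simp

lemma flinear_sum:
  assumes "flinear f" "finite B"
  shows "f (\<Sum>b\<in>B. g b) = (\<Sum>b\<in>B. f (g b))"
  using assms(2)
proof induction
  case empty
  show ?case using flinear_zero[OF assms(1)] by (simp add: zero_fun_def)
next
  case (insert x F)
  then show ?case using flinear_add[OF assms(1), of "g x" "sum g F"] by (simp add: plus_fun_def)
qed

lemma flinear_lincomb:
  assumes "flinear f" "finite B"
  shows "f (\<Sum>b\<in>B. (\<lambda>t. u b *\<^sub>R g b t)) = (\<Sum>b\<in>B. (\<lambda>t. u b *\<^sub>R f (g b) t))"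
  unfolding flinear_sum[OF assms] by (rule sum.cong) (auto simp: flinear_scale[OF assms(1)])

lemma hasdim_subspace: "hasdim S n \<Longrightarrow> FV.subspace S"
  unfolding hasdim_def by auto

text \<open>Rank-nullity used upwards: a basis of the kernel together with preimages of a basis of
  the image is a basis of \<open>S\<close>. All dimension formulas below are built by this
  step.\<close>

lemma hasdim_kernel_image:
  fixes f :: "('a \<Rightarrow> 'b::real_vector) \<Rightarrow> ('c \<Rightarrow> 'e::real_vector)"
  assumes S: "FV.subspace S" and f: "flinear f"
    and K: "hasdim {x\<in>S. f x = 0} m" and I: "hasdim (f ` S) n"
  shows "hasdim S (m + n)"
proof -
  obtain B where B: "finite B" "card B = m" "FV.independent B" "FV.span B = {x\<in>S. f x = 0}"
    using K unfolding hasdim_def by blast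
  obtain C where C: "finite C" "card C = n" "FV.independent C" "FV.span C = f ` S"
    using I unfolding hasdim_def by blast
  have "\<forall>y\<in>C. \<exists>x\<in>S. f x = y" using C(4) FV.span_superset[of C] by force
  then obtain g where g: "\<And>y. y \<in> C \<Longrightarrow> g y \<in> S" "\<And>y. y \<in> C \<Longrightarrow> f (g y) = y" by metis
  have inj: "inj_on g C" using g(2) by (metis inj_onI)
  have BS: "B \<subseteq> S" "\<And>x. x \<in> B \<Longrightarrow> f x = 0" using B(4) FV.span_superset[of B] by auto
  have "0 \<notin> C" using C(3) FV.dependent_zero by blast
  then have disj: "B \<inter> g ` C = {}" using BS(2) g(2) by fastforce
  have card: "card (B \<union> g ` C) = m + n"
    using B C inj disj by (simp add: card_Un_disjoint card_image)
  have indep: "FV.independent (B \<union> g ` C)"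
  proof (rule FV.independent_if_scalars_zero)
    show "finite (B \<union> g ` C)" using B C by simp
    fix u x
    assume z: "(\<Sum>x\<in>B \<union> g ` C. (\<lambda>t. u x *\<^sub>R x t)) = 0" and x: "x \<in> B \<union> g ` C"
    have eq: "(\<Sum>x\<in>B. (\<lambda>t. u x *\<^sub>R x t)) + (\<Sum>y\<in>C. (\<lambda>t. u (g y) *\<^sub>R g y t)) = 0"
      using z B C disj by (simp add: sum.union_disjoint sum.reindex[OF inj])
    have "f (\<Sum>x\<in>B. (\<lambda>t. u x *\<^sub>R x t)) + f (\<Sum>y\<in>C. (\<lambda>t. u (g y) *\<^sub>R g y t)) = 0"
      using arg_cong[OF eq, of f] by (simp add: flinear_add[OF f] flinear_zero[OF f])
    moreover have "f (\<Sum>x\<in>B. (\<lambda>t. u x *\<^sub>R x t)) = 0"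
      unfolding flinear_lincomb[OF f B(1)] by (rule sum.neutral) (auto simp: BS(2) zero_fun_def)
    moreover have "f (\<Sum>y\<in>C. (\<lambda>t. u (g y) *\<^sub>R g y t)) = (\<Sum>y\<in>C. (\<lambda>t. u (g y) *\<^sub>R y t))"
      unfolding flinear_lincomb[OF f C(1)] by (rule sum.cong) (auto simp: g(2))
    ultimately have zC: "(\<Sum>y\<in>C. (\<lambda>t. u (g y) *\<^sub>R y t)) = 0" by simp
    have uC: "u (g y) = 0" if "y \<in> C" for y
      using FV.independentD[OF C(3) C(1) subset_refl zC that] .
    then have "(\<Sum>y\<in>C. (\<lambda>t. u (g y) *\<^sub>R g y t)) = 0"
      by (intro sum.neutral) (auto simp: zero_fun_def)
    then have zB: "(\<Sum>x\<in>B. (\<lambda>t. u x *\<^sub>R x t)) = 0" using eq by simp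
    have "u x = 0" if "x \<in> B" for x
      using FV.independentD[OF B(3) B(1) subset_refl zB that] .
    then show "u x = 0" using x uC by auto
  qed
  have "FV.span (B \<union> g ` C) = S"
  proof
    show "FV.span (B \<union> g ` C) \<subseteq> S"
      using BS g by (intro FV.span_minimal S) auto
    show "S \<subseteq> FV.span (B \<union> g ` C)"
    proof
      fix x assume x: "x \<in> S"
      then have "f x \<in> FV.span C" using C(4) by auto
      then obtain u where u: "f x = (\<Sum>y\<in>C. (\<lambda>t. u y *\<^sub>R y t))"
        unfolding FV.span_finite[OF C(1)] by auto
      define z where "z = (\<Sum>y\<in>C. (\<lambda>t. u y *\<^sub>R g y t))"
      have fz: "f z = f x"
        unfolding z_def flinear_lincomb[OF f C(1)] u by (rule sum.cong) (auto simp: g(2))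
      have "z \<in> S" unfolding z_def
        by (intro FV.subspace_sum[OF S] FV.subspace_scale[OF S] g)
      then have "x - z \<in> FV.span B"
        unfolding B(4) using x fz by (auto simp: flinear_diff[OF f] intro: FV.subspace_diff[OF S])
      then have 1: "x - z \<in> FV.span (B \<union> g ` C)" using FV.span_mono[of B "B \<union> g ` C"] by auto
      have 2: "z \<in> FV.span (B \<union> g ` C)"
        unfolding z_def by (intro FV.span_sum FV.span_scale FV.span_base) auto
      show "x \<in> FV.span (B \<union> g ` C)" using FV.span_add[OF 1 2] by simp
    qed
  qed
  then show ?thesis
    unfolding hasdim_def using card indep B(1) C(1) by (intro exI[of _ "B \<union> g ` C"]) auto
qed

lemma hasdim_inj_image:
  fixes f :: "('a \<Rightarrow> 'b::real_vector) \<Rightarrow> ('c \<Rightarrow> 'e::real_vector)"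
  assumes S: "hasdim S n" and f: "flinear f" and inj: "\<And>x. x \<in> S \<Longrightarrow> f x = 0 \<Longrightarrow> x = 0"
  shows "hasdim (f ` S) n"
proof -
  obtain B where B: "finite B" "card B = n" "FV.independent B" "FV.span B = S"
    using S unfolding hasdim_def by blast
  have sub: "FV.subspace S" using hasdim_subspace[OF S] .
  have BS: "B \<subseteq> S" using B(4) FV.span_superset[of B] by auto
  have injS: "inj_on f S"
  proof (rule inj_onI)
    fix x y assume "x \<in> S" "y \<in> S" "f x = f y"
    then have "x - y = 0" by (intro inj FV.subspace_diff[OF sub]) (simp_all add: flinear_diff[OF f])
    then show "x = y" by simp
  qed
  then have injB: "inj_on f B" using BS inj_on_subset by blast
  have ind: "FV.independent (f ` B)"
  proof (rule FV.independent_if_scalars_zero)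
    show "finite (f ` B)" using B by simp
    fix u y assume z: "(\<Sum>x\<in>f ` B. (\<lambda>t. u x *\<^sub>R x t)) = 0" and y: "y \<in> f ` B"
    have "f (\<Sum>x\<in>B. (\<lambda>t. u (f x) *\<^sub>R x t)) = 0"
      unfolding flinear_lincomb[OF f B(1)] using z by (simp add: sum.reindex[OF injB])
    moreover have "(\<Sum>x\<in>B. (\<lambda>t. u (f x) *\<^sub>R x t)) \<in> S"
      using BS by (intro FV.subspace_sum[OF sub] FV.subspace_scale[OF sub]) auto
    ultimately have z: "(\<Sum>x\<in>B. (\<lambda>t. u (f x) *\<^sub>R x t)) = 0" by (rule inj[rotated])
    obtain x where "x \<in> B" "y = f x" using y by auto
    then show "u y = 0" using FV.independentD[OF B(3) B(1) subset_refl z, of x] by simp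
  qed
  have "FV.span (f ` B) = f ` S"
  proof -
    have "FV.span (f ` B) = range (\<lambda>u. \<Sum>x\<in>f ` B. (\<lambda>t. u x *\<^sub>R x t))"
      using B(1) by (simp add: FV.span_finite)
    also have "\<dots> = range (\<lambda>u. \<Sum>x\<in>B. (\<lambda>t. u (f x) *\<^sub>R f x t))"
      by (simp add: sum.reindex[OF injB])
    \<comment> \<open>Since \<open>f\<close> is injective on \<open>B\<close>, every coefficient
      family on \<open>B\<close> factors through \<open>f\<close>.\<close>
    also have "\<dots> = range (\<lambda>v. \<Sum>x\<in>B. (\<lambda>t. v x *\<^sub>R f x t))"
    proof safe
      fix v :: "('a \<Rightarrow> 'b) \<Rightarrow> real"
      have "(\<Sum>x\<in>B. (\<lambda>t. v x *\<^sub>R f x t)) = (\<Sum>x\<in>B. (\<lambda>t. v (inv_into B f (f x)) *\<^sub>R f x t))"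
        by (rule sum.cong) (auto simp: inv_into_f_f[OF injB])
      then show "(\<Sum>x\<in>B. (\<lambda>t. v x *\<^sub>R f x t)) \<in> range (\<lambda>u. \<Sum>x\<in>B. (\<lambda>t. u (f x) *\<^sub>R f x t))"
        by (intro range_eqI[of _ _ "\<lambda>y. v (inv_into B f y)"])
    qed auto
    also have "\<dots> = f ` range (\<lambda>v. \<Sum>x\<in>B. (\<lambda>t. v x *\<^sub>R x t))"
      by (auto simp: image_image flinear_lincomb[OF f B(1)])
    also have "\<dots> = f ` S" using B by (simp add: FV.span_finite)
    finally show ?thesis .
  qed
  then show ?thesis
    unfolding hasdim_def using ind B injB by (intro exI[of _ "f ` B"]) (auto simp: card_image)
qed

section \<open>Spaces of fields with prescribed scalar coefficient spaces\<close>

lemma hasdim_singleton_0: "hasdim {0} 0"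
  unfolding hasdim_def by (intro exI[of _ "{}"]) (auto simp: FV.independent_empty)

text \<open>The common shape of \<open>Sigma_k\<close>, \<open>Bub\<close> and
  \<open>facet_tests\<close>: fixed directions \<open>m j\<close>, each with its own space
  \<open>Q j\<close> of scalar coefficient functions.\<close>

definition combos :: "('j \<Rightarrow> 'm::real_vector) \<Rightarrow> ('j \<Rightarrow> ('a \<Rightarrow> real) set) \<Rightarrow> 'j set \<Rightarrow> ('a \<Rightarrow> 'm) set" where
  "combos m Q J = {\<tau>. \<exists>a. (\<forall>j\<in>J. a j \<in> Q j) \<and> \<tau> = (\<lambda>x. \<Sum>j\<in>J. a j x *\<^sub>R m j)}"

lemma combosI: "(\<And>j. j \<in> J \<Longrightarrow> a j \<in> Q j) \<Longrightarrow> (\<lambda>x. \<Sum>j\<in>J. a j x *\<^sub>R m j) \<in> combos m Q J"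
  unfolding combos_def by blast

lemma combosE:
  assumes "\<tau> \<in> combos m Q J"
  obtains a where "\<And>j. j \<in> J \<Longrightarrow> a j \<in> Q j" "\<tau> = (\<lambda>x. \<Sum>j\<in>J. a j x *\<^sub>R m j)"
  using assms unfolding combos_def by blast

lemma subspace_combos:
  assumes "\<And>j. j \<in> J \<Longrightarrow> FV.subspace (Q j)"
  shows "FV.subspace (combos m Q J)"
proof (rule FV.subspaceI)
  show "0 \<in> combos m Q J" unfolding combos_def
    using assms by (auto intro!: exI[of _ 0] FV.subspace_0 simp: fun_eq_iff)
next
  fix x y assume "x \<in> combos m Q J" "y \<in> combos m Q J"
  then obtain a b where a: "\<forall>j\<in>J. a j \<in> Q j" "x = (\<lambda>x. \<Sum>j\<in>J. a j x *\<^sub>R m j)"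
    and b: "\<forall>j\<in>J. b j \<in> Q j" "y = (\<lambda>x. \<Sum>j\<in>J. b j x *\<^sub>R m j)" unfolding combos_def by blast
  then show "x + y \<in> combos m Q J" unfolding combos_def
    using assms by (auto intro!: exI[of _ "\<lambda>j. a j + b j"] FV.subspace_add
        simp: fun_eq_iff sum.distrib algebra_simps)
next
  fix c x assume "x \<in> combos m Q J"
  then obtain a where a: "\<forall>j\<in>J. a j \<in> Q j" "x = (\<lambda>x. \<Sum>j\<in>J. a j x *\<^sub>R m j)"
    unfolding combos_def by blast
  moreover have "(\<lambda>t. c *\<^sub>R a j t) \<in> Q j" if "j \<in> J" for j
    using FV.subspace_scale[OF assms[OF that]] a(1) that by blast
  ultimately show "(\<lambda>t. c *\<^sub>R x t) \<in> combos m Q J" unfolding combos_def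
    by (auto intro!: exI[of _ "\<lambda>j t. c * a j t"] simp: scaleR_sum_right)
qed

text \<open>The functional \<open>\<mu> j\<close> reads off the coefficient of the newly inserted
  index. Its image is \<open>Q j\<close> and its kernel consists of the combinations over the
  remaining indices, so rank-nullity adds \<open>n j\<close>.\<close>

lemma hasdim_combos:
  fixes m :: "'j \<Rightarrow> 'm::real_vector" and Q :: "'j \<Rightarrow> ('a \<Rightarrow> real) set" and \<mu> :: "'j \<Rightarrow> 'm \<Rightarrow> real"
  assumes "finite J" "\<And>j. j \<in> J \<Longrightarrow> hasdim (Q j) (n j)"
    and lin: "\<And>j. j \<in> J \<Longrightarrow> linear (\<mu> j)"
    and dual: "\<And>i j. i \<in> J \<Longrightarrow> j \<in> J \<Longrightarrow> \<mu> i (m j) = (if i = j then 1 else 0)"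
  shows "hasdim (combos m Q J) (\<Sum>j\<in>J. n j)"
  using assms
proof (induction J rule: finite_induct)
  case empty
  have "combos m Q {} = {0}" by (auto simp: combos_def zero_fun_def)
  then show ?case by (simp add: hasdim_singleton_0)
next
  case (insert j J)
  define f where "f = (\<lambda>(\<tau>::'a \<Rightarrow> 'm) x. \<mu> j (\<tau> x))"
  have lin: "linear (\<mu> j)" using insert by simp
  have f: "flinear f"
    by (auto simp: flinear_def f_def fun_eq_iff linear_add[OF lin] linear_scale[OF lin])
  have comp: "f (\<lambda>x. \<Sum>i\<in>insert j J. a i x *\<^sub>R m i) = a j" for a
  proof
    fix x
    have "(\<Sum>i\<in>J. a i x * \<mu> j (m i)) = 0"
      using insert by (intro sum.neutral) auto
    then show "f (\<lambda>x. \<Sum>i\<in>insert j J. a i x *\<^sub>R m i) x = a j x"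
      using insert by (simp add: f_def linear_add[OF lin] linear_scale[OF lin] linear_sum[OF lin])
  qed
  have sub: "\<And>i. i \<in> insert j J \<Longrightarrow> FV.subspace (Q i)"
    using insert.prems(1) hasdim_subspace by blast
  have zero: "0 \<in> Q i" if "i \<in> insert j J" for i
    using FV.subspace_0[OF sub[OF that]] .
  have im: "f ` combos m Q (insert j J) = Q j"
  proof
    show "f ` combos m Q (insert j J) \<subseteq> Q j"
      by (auto elim!: combosE simp only: comp)
    show "Q j \<subseteq> f ` combos m Q (insert j J)"
    proof
      fix q assume q: "q \<in> Q j"
      define a where "a = (\<lambda>i. if i = j then q else 0)"
      have "(\<lambda>x. \<Sum>i\<in>insert j J. a i x *\<^sub>R m i) \<in> combos m Q (insert j J)"
        using q zero by (intro combosI) (auto simp: a_def)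
      moreover have "q = f (\<lambda>x. \<Sum>i\<in>insert j J. a i x *\<^sub>R m i)"
        unfolding comp by (simp add: a_def)
      ultimately show "q \<in> f ` combos m Q (insert j J)" by (simp only: image_eqI)
    qed
  qed
  have ker: "{\<tau>\<in>combos m Q (insert j J). f \<tau> = 0} = combos m Q J"
  proof (intro set_eqI iffI)
    fix \<tau> assume t: "\<tau> \<in> {\<tau>\<in>combos m Q (insert j J). f \<tau> = 0}"
    then obtain a where a: "\<And>i. i \<in> insert j J \<Longrightarrow> a i \<in> Q i" "\<tau> = (\<lambda>x. \<Sum>i\<in>insert j J. a i x *\<^sub>R m i)"
      by (auto elim: combosE)
    have "a j = 0" using t unfolding a(2) by (simp only: comp mem_Collect_eq)
    then have "\<tau> = (\<lambda>x. \<Sum>i\<in>J. a i x *\<^sub>R m i)" using a(2) insert.hyps by simp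
    then show "\<tau> \<in> combos m Q J" using a(1) by (auto intro: combosI)
  next
    fix \<tau> assume "\<tau> \<in> combos m Q J"
    then obtain a where a: "\<And>i. i \<in> J \<Longrightarrow> a i \<in> Q i" "\<tau> = (\<lambda>x. \<Sum>i\<in>J. a i x *\<^sub>R m i)"
      by (auto elim: combosE)
    define a' where "a' = (\<lambda>i. if i = j then 0 else a i)"
    have a'J: "\<And>i. i \<in> J \<Longrightarrow> a' i = a i" using insert.hyps unfolding a'_def by auto
    have t: "\<tau> = (\<lambda>x. \<Sum>i\<in>insert j J. a' i x *\<^sub>R m i)"
      unfolding a(2) using insert.hyps a'J by (simp add: a'_def cong: sum.cong)
    have "\<tau> \<in> combos m Q (insert j J)" unfolding t
      by (rule combosI) (use a(1) zero in \<open>auto simp: a'_def\<close>)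
    moreover have "f \<tau> = 0" unfolding t comp by (simp add: a'_def zero_fun_def)
    ultimately show "\<tau> \<in> {\<tau>\<in>combos m Q (insert j J). f \<tau> = 0}" by blast
  qed
  have "hasdim (combos m Q (insert j J)) ((\<Sum>j\<in>J. n j) + n j)"
    by (rule hasdim_kernel_image[OF subspace_combos[OF sub] f])
       (use insert in \<open>simp_all add: im ker\<close>)
  then show ?case using insert.hyps by (simp add: add.commute)
qed

section \<open>Polynomial spaces\<close>

definition mon :: "('d::finite \<Rightarrow> nat) \<Rightarrow> real^'d \<Rightarrow> real" where
  "mon \<alpha> x = (\<Prod>i\<in>UNIV. (x $ i) ^ \<alpha> i)"

definition polyspace :: "'d::finite set \<Rightarrow> nat \<Rightarrow> (real^'d \<Rightarrow> real) set" where
  "polyspace I k = FV.span (mon ` {\<alpha>. sum \<alpha> UNIV \<le> k \<and> (\<forall>i. i \<notin> I \<longrightarrow> \<alpha> i = 0)})"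

lemma subspace_polyspace: "FV.subspace (polyspace I k)"
  unfolding polyspace_def by (rule FV.subspace_span)

lemma polyspace_add: "f \<in> polyspace I k \<Longrightarrow> g \<in> polyspace I k \<Longrightarrow> (\<lambda>x. f x + g x) \<in> polyspace I k"
  using FV.subspace_add[OF subspace_polyspace[of I k], of f g] by (simp add: plus_fun_def)

lemma polyspace_scale: "f \<in> polyspace I k \<Longrightarrow> (\<lambda>x. c * f x) \<in> polyspace I k"
  using FV.subspace_scale[OF subspace_polyspace[of I k], of f c] by simp

lemma polyspace_0: "(\<lambda>x. 0) \<in> polyspace I k"
  using FV.subspace_0[OF subspace_polyspace[of I k]] by (simp add: zero_fun_def)

lemma polyspace_diff: "f \<in> polyspace I k \<Longrightarrow> g \<in> polyspace I k \<Longrightarrow> (\<lambda>x. f x - g x) \<in> polyspace I k"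
  using polyspace_add[of f I k "\<lambda>x. - 1 * g x"] polyspace_scale[of g I k "- 1"] by simp

lemma polyspace_sum:
  "(\<And>j. j \<in> J \<Longrightarrow> f j \<in> polyspace I k) \<Longrightarrow> (\<lambda>x. \<Sum>j\<in>J. f j x) \<in> polyspace I k"
  by (induction J rule: infinite_finite_induct) (auto intro: polyspace_0 polyspace_add)

lemma mon_in_polyspace: "sum \<alpha> UNIV \<le> k \<Longrightarrow> (\<And>i. i \<notin> I \<Longrightarrow> \<alpha> i = 0) \<Longrightarrow> mon \<alpha> \<in> polyspace I k"
  unfolding polyspace_def by (rule FV.span_base) auto

lemma polyspace_induct [consumes 1, case_names zero add scale mon]:
  assumes "f \<in> polyspace I k" and 0: "Q (\<lambda>x. 0)"
    and add: "\<And>f g. Q f \<Longrightarrow> Q g \<Longrightarrow> Q (\<lambda>x. f x + g x)"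
    and scale: "\<And>c f. Q f \<Longrightarrow> Q (\<lambda>x. c * f x)"
    and mon: "\<And>\<alpha>. sum \<alpha> UNIV \<le> k \<Longrightarrow> (\<And>i. i \<notin> I \<Longrightarrow> \<alpha> i = 0) \<Longrightarrow> Q (mon \<alpha>)"
  shows "Q f"
proof -
  have sub: "FV.subspace {f. Q f}"
    by (rule FV.subspaceI) (use 0 add scale in \<open>auto simp: zero_fun_def plus_fun_def\<close>)
  have "polyspace I k \<subseteq> {f. Q f}"
    unfolding polyspace_def by (rule FV.span_minimal[OF _ sub]) (use mon in auto)
  then show ?thesis using assms(1) by blast
qed

lemma finite_multiindices: "finite {\<alpha>::'d::finite \<Rightarrow> nat. sum \<alpha> UNIV \<le> k}"
proof (rule finite_subset)
  show "{\<alpha>::'d \<Rightarrow> nat. sum \<alpha> UNIV \<le> k} \<subseteq> PiE UNIV (\<lambda>_. {..k})"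
  proof
    fix \<alpha> :: "'d \<Rightarrow> nat" assume "\<alpha> \<in> {\<alpha>. sum \<alpha> UNIV \<le> k}"
    moreover have "\<alpha> i \<le> sum \<alpha> UNIV" for i by (rule member_le_sum) auto
    ultimately show "\<alpha> \<in> PiE UNIV (\<lambda>_. {..k})" by (auto intro: order_trans)
  qed
  show "finite (PiE (UNIV :: 'd set) (\<lambda>_. {..k}))" by (intro finite_PiE) auto
qed

lemma polyfun_iff_polyspace: "polyfun k f \<longleftrightarrow> f \<in> polyspace UNIV k"
proof
  assume "polyfun k f"
  then obtain c where c: "\<And>x. f x = (\<Sum>\<alpha>\<in>{\<alpha>. sum \<alpha> UNIV \<le> k}. c \<alpha> * mon \<alpha> x)"
    unfolding polyfun_def mon_def by blast
  have "(\<lambda>x. \<Sum>\<alpha>\<in>{\<alpha>. sum \<alpha> UNIV \<le> k}. c \<alpha> * mon \<alpha> x) \<in> polyspace UNIV k"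
    by (intro polyspace_sum polyspace_scale mon_in_polyspace) auto
  moreover have "f = (\<lambda>x. \<Sum>\<alpha>\<in>{\<alpha>. sum \<alpha> UNIV \<le> k}. c \<alpha> * mon \<alpha> x)" using c by (rule ext)
  ultimately show "f \<in> polyspace UNIV k" by simp
next
  assume "f \<in> polyspace UNIV k"
  then have "\<exists>c. f = (\<lambda>x. \<Sum>\<alpha>\<in>{\<alpha>. sum \<alpha> UNIV \<le> k}. c \<alpha> * mon \<alpha> x)"
  proof (induction rule: polyspace_induct)
    case zero
    then show ?case by (intro exI[of _ "\<lambda>_. 0"]) simp
  next
    case (add f g)
    then obtain c e where "f = (\<lambda>x. \<Sum>\<alpha>\<in>{\<alpha>. sum \<alpha> UNIV \<le> k}. c \<alpha> * mon \<alpha> x)"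
      "g = (\<lambda>x. \<Sum>\<alpha>\<in>{\<alpha>. sum \<alpha> UNIV \<le> k}. e \<alpha> * mon \<alpha> x)" by blast
    then show ?case
      by (intro exI[of _ "\<lambda>\<alpha>. c \<alpha> + e \<alpha>"]) (simp add: algebra_simps sum.distrib)
  next
    case (scale r f)
    then obtain c where "f = (\<lambda>x. \<Sum>\<alpha>\<in>{\<alpha>. sum \<alpha> UNIV \<le> k}. c \<alpha> * mon \<alpha> x)" by blast
    then show ?case
      by (intro exI[of _ "\<lambda>\<alpha>. r * c \<alpha>"]) (simp add: sum_distrib_left mult.assoc)
  next
    case (mon \<beta>)
    have "mon \<beta> x = (\<Sum>\<alpha>\<in>{\<alpha>. sum \<alpha> UNIV \<le> k}. (if \<alpha> = \<beta> then 1 else 0) * mon \<alpha> x)" for x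
      using mon by (simp add: finite_multiindices if_distrib[where f = "\<lambda>t. t * _"] cong: if_cong)
    then show ?case by (intro exI[of _ "\<lambda>\<alpha>. if \<alpha> = \<beta> then 1 else 0"]) (simp add: fun_eq_iff)
  qed
  then show "polyfun k f" unfolding polyfun_def mon_def by auto
qed

lemma mon_0: "mon (\<lambda>_. 0) = (\<lambda>x. 1)"
  by (simp add: mon_def fun_eq_iff)

lemma mon_mult: "mon \<alpha> x * mon \<beta> x = mon (\<lambda>i. \<alpha> i + \<beta> i) x"
  by (simp add: mon_def power_add prod.distrib)

lemma polyspace_const: "(\<lambda>x. c) \<in> polyspace I k"
  using polyspace_scale[OF mon_in_polyspace[of "\<lambda>_. 0" k I], of c] by (simp add: mon_0)

lemma polyspace_mono: "I \<subseteq> J \<Longrightarrow> j \<le> k \<Longrightarrow> polyspace I j \<subseteq> polyspace J k"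
  unfolding polyspace_def by (intro FV.span_mono image_mono) auto

lemma polyspace_coord: "i \<in> I \<Longrightarrow> 1 \<le> k \<Longrightarrow> (\<lambda>x. x $ i) \<in> polyspace I k"
proof -
  assume "i \<in> I" "1 \<le> k"
  then have "mon (\<lambda>j. if j = i then 1 else 0) \<in> polyspace I k"
    by (intro mon_in_polyspace) auto
  moreover have "mon (\<lambda>j. if j = i then 1 else 0) = (\<lambda>x. x $ i)"
    by (simp add: mon_def fun_eq_iff if_distrib[where f = "\<lambda>n. _ ^ n"] cong: if_cong)
  ultimately show ?thesis by simp
qed

lemma polyspace_mult:
  assumes "f \<in> polyspace I j" "g \<in> polyspace I k"
  shows "(\<lambda>x. f x * g x) \<in> polyspace I (j + k)"
  using assms(1)
proof (induction rule: polyspace_induct)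
  case zero
  then show ?case by (simp add: polyspace_0)
next
  case (add f h)
  then show ?case using polyspace_add[OF add] by (simp add: algebra_simps)
next
  case (scale c f)
  then show ?case using polyspace_scale[OF scale, of c] by (simp add: algebra_simps)
next
  case (mon \<alpha>)
  show ?case using assms(2)
  proof (induction rule: polyspace_induct)
    case zero
    then show ?case by (simp add: polyspace_0)
  next
    case (add f h)
    then show ?case using polyspace_add[OF add] by (simp add: algebra_simps)
  next
    case (scale c f)
    then show ?case using polyspace_scale[OF scale, of c] by (simp add: algebra_simps)
  next
    case (mon \<beta>)
    then show ?case using \<open>sum \<alpha> UNIV \<le> j\<close> \<open>\<And>i. i \<notin> I \<Longrightarrow> \<alpha> i = 0\<close>
      unfolding mon_mult by (intro mon_in_polyspace) (auto simp: sum.distrib)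
  qed
qed

lemma polyspace_power: "f \<in> polyspace I 1 \<Longrightarrow> (\<lambda>x. f x ^ n) \<in> polyspace I n"
proof (induction n)
  case (Suc n)
  then show ?case using polyspace_mult[of f I 1 "\<lambda>x. f x ^ n" n] by simp
qed (simp add: polyspace_const)

lemma polyspace_prod_power:
  "finite A \<Longrightarrow> (\<And>i. i \<in> A \<Longrightarrow> f i \<in> polyspace I 1) \<Longrightarrow>
    (\<lambda>x. \<Prod>i\<in>A. f i x ^ n i) \<in> polyspace I (sum n A)"
proof (induction A rule: finite_induct)
  case (insert a A)
  then show ?case using polyspace_mult[OF polyspace_power[of "f a" I "n a"]] by simp
qed (simp add: polyspace_const)

lemma polyspace_compose:
  assumes "f \<in> polyspace I k" "\<And>i. (\<lambda>x. \<psi> x $ i) \<in> polyspace J 1"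
  shows "(\<lambda>x. f (\<psi> x)) \<in> polyspace J k"
  using assms(1)
proof (induction rule: polyspace_induct)
  case (mon \<alpha>)
  have "(\<lambda>x. mon \<alpha> (\<psi> x)) \<in> polyspace J (sum \<alpha> UNIV)"
    unfolding mon_def by (rule polyspace_prod_power) (use assms(2) in auto)
  then show ?case using polyspace_mono[of J J "sum \<alpha> UNIV" k] mon by auto
qed (auto intro: polyspace_0 polyspace_add polyspace_scale)

lemma polyspace_continuous: "f \<in> polyspace I k \<Longrightarrow> continuous_on S f"
proof (induction rule: polyspace_induct)
  case (mon \<alpha>)
  then show ?case unfolding mon_def by (intro continuous_intros)
qed (auto intro: continuous_intros)

section \<open>Zeros of polynomials on lines and affine hulls\<close>

lemma polyspace_on_line:
  assumes "f \<in> polyspace I k"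
  shows "\<exists>p :: real poly. \<forall>t. f (c + t *\<^sub>R v) = poly p t"
  using assms
proof (induction rule: polyspace_induct)
  case zero
  then show ?case by (intro exI[of _ 0]) simp
next
  case (add f g)
  then obtain p q where "\<forall>t. f (c + t *\<^sub>R v) = poly p t" "\<forall>t. g (c + t *\<^sub>R v) = poly q t" by blast
  then show ?case by (intro exI[of _ "p + q"]) simp
next
  case (scale r f)
  then obtain p where "\<forall>t. f (c + t *\<^sub>R v) = poly p t" by blast
  then show ?case by (intro exI[of _ "smult r p"]) simp
next
  case (mon \<alpha>)
  show ?case
    by (intro exI[of _ "\<Prod>i\<in>UNIV. [:c $ i, v $ i:] ^ \<alpha> i"]) (simp add: mon_def poly_prod)
qed

lemma polyspace_line_zero:
  assumes "f \<in> polyspace I k" "infinite {t. f (c + t *\<^sub>R v) = 0}"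
  shows "f (c + t *\<^sub>R v) = 0"
proof -
  obtain p where p: "\<And>t. f (c + t *\<^sub>R v) = poly p t" using polyspace_on_line[OF assms(1)] by blast
  then have "p = 0" using assms(2) poly_roots_finite[of p] by auto
  then show ?thesis using p by simp
qed

text \<open>On the line from the barycentre of \<open>W\<close> to \<open>x\<close> the coefficients
  are \<open>(1 - t) / n + t * u w\<close>, close to \<open>1 / n\<close> for small
  \<open>t\<close>. So an initial piece lies in the convex hull, \<open>f\<close> has infinitely
  many zeros on the line, and it vanishes at \<open>t = 1\<close> too.\<close>

lemma polyspace_zero_on_affine_hull:
  assumes f: "f \<in> polyspace I k" and W: "finite W" and z: "\<And>x. x \<in> convex hull W \<Longrightarrow> f x = 0"
    and x: "x \<in> affine hull W"
  shows "f x = 0"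
proof -
  obtain u where u: "sum u W = 1" "(\<Sum>w\<in>W. u w *\<^sub>R w) = x"
    using x by (auto simp: affine_hull_finite[OF W])
  have ne: "W \<noteq> {}" using u by auto
  define n where "n = real (card W)"
  have n: "n > 0" using W ne by (simp add: n_def card_gt_0_iff)
  define c where "c = (\<Sum>w\<in>W. (1 / n) *\<^sub>R w)"
  have small: "\<forall>\<^sub>F t in at_right 0. \<forall>w\<in>W. 0 \<le> (1 - t) / n + t * u w"
  proof (intro eventually_ball_finite W ballI)
    fix w assume "w \<in> W"
    have "((\<lambda>t. (1 - t) / n + t * u w) \<longlongrightarrow> (1 - 0) / n + 0 * u w) (at_right 0)"
      by (intro tendsto_intros) (use n in auto)
    then have "\<forall>\<^sub>F t in at_right 0. 0 < (1 - t) / n + t * u w"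
      by (rule order_tendstoD) (use n in simp)
    then show "\<forall>\<^sub>F t in at_right 0. 0 \<le> (1 - t) / n + t * u w"
      by (rule eventually_mono) simp
  qed
  then obtain e where e: "e > 0" "\<And>t w. 0 < t \<Longrightarrow> t < e \<Longrightarrow> w \<in> W \<Longrightarrow> 0 \<le> (1 - t) / n + t * u w"
    unfolding eventually_at_right_field by auto
  have "f (c + t *\<^sub>R (x - c)) = 0" if t: "0 < t" "t < e" for t
  proof (rule z)
    have "c + t *\<^sub>R (x - c) = (\<Sum>w\<in>W. ((1 - t) / n + t * u w) *\<^sub>R w)"
      unfolding u(2)[symmetric] c_def
      by (simp add: scaleR_sum_right sum.distrib[symmetric] sum_subtractf[symmetric] algebra_simps diff_divide_distrib)
    moreover have "(\<Sum>w\<in>W. (1 - t) / n + t * u w) = 1"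
      using u(1) n by (simp add: sum.distrib sum_distrib_left[symmetric] n_def)
    ultimately show "c + t *\<^sub>R (x - c) \<in> convex hull W"
      unfolding convex_hull_finite[OF W] mem_Collect_eq using e(2)[OF t]
      by (intro exI[of _ "\<lambda>w. (1 - t) / n + t * u w"]) auto
  qed
  then have "{0<..<e} \<subseteq> {t. f (c + t *\<^sub>R (x - c)) = 0}" by auto
  then have "infinite {t. f (c + t *\<^sub>R (x - c)) = 0}"
    using infinite_Ioo[OF e(1)] infinite_super by blast
  from polyspace_line_zero[OF f this, of 1] show ?thesis by simp
qed

section \<open>Restriction to a coordinate hyperplane\<close>

definition drop_coord :: "'d \<Rightarrow> real^'d \<Rightarrow> real^'d" where
  "drop_coord i x = (\<chi> j. if j = i then 0 else x $ j)"

lemma drop_coord_nth: "drop_coord i x $ j = (if j = i then 0 else x $ j)"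
  by (simp add: drop_coord_def)

lemma drop_coord_idem: "drop_coord i (drop_coord i x) = drop_coord i x"
  by (simp add: vec_eq_iff drop_coord_nth)

lemma drop_coord_id: "x $ i = 0 \<Longrightarrow> drop_coord i x = x"
  by (simp add: vec_eq_iff drop_coord_nth)

lemma mon_split: "mon \<alpha> x = (x $ i) ^ \<alpha> i * (\<Prod>j\<in>UNIV - {i}. (x $ j) ^ \<alpha> j)"
  unfolding mon_def by (rule prod.remove) auto

lemma mon_drop_coord: "mon \<alpha> (drop_coord i x) = (if \<alpha> i = 0 then mon \<alpha> x else 0)"
proof -
  have "(\<Prod>j\<in>UNIV - {i}. (drop_coord i x $ j) ^ \<alpha> j) = (\<Prod>j\<in>UNIV - {i}. (x $ j) ^ \<alpha> j)"
    by (rule prod.cong) (auto simp: drop_coord_nth)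
  then show ?thesis unfolding mon_split[of _ _ i] by (simp add: drop_coord_nth)
qed

lemma polyspace_drop_coord: "f \<in> polyspace I k \<Longrightarrow> (\<lambda>x. f (drop_coord i x)) \<in> polyspace (I - {i}) k"
proof (induction rule: polyspace_induct)
  case (mon \<alpha>)
  have "mon \<alpha> \<in> polyspace (I - {i}) k" if "\<alpha> i = 0"
  proof (rule mon_in_polyspace[OF mon(1)])
    fix j assume "j \<notin> I - {i}"
    then show "\<alpha> j = 0" using mon(2)[of j] that by (cases "j = i") auto
  qed
  then show ?case by (cases "\<alpha> i = 0") (simp_all add: mon_drop_coord polyspace_0)
qed (auto intro: polyspace_0 polyspace_add polyspace_scale)

lemma polyspace_drop_coord_id: "f \<in> polyspace (I - {i}) k \<Longrightarrow> f (drop_coord i x) = f x"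
proof (induction rule: polyspace_induct)
  case (mon \<alpha>)
  have "\<alpha> i = 0" by (rule mon(2)) simp
  then show ?case by (simp add: mon_drop_coord)
qed simp_all

text \<open>Division by the coordinate \<open>x $ i\<close>, with the restriction to the hyperplane
  as remainder. The point is that the quotient loses one degree.\<close>

lemma polyspace_division:
  assumes "f \<in> polyspace I (Suc k)"
  shows "\<exists>q\<in>polyspace I k. \<forall>x. f x = f (drop_coord i x) + x $ i * q x"
  using assms
proof (induction rule: polyspace_induct)
  case zero
  then show ?case using polyspace_0 by (auto intro: bexI[of _ "\<lambda>x. 0"])
next
  case (add f g)
  then obtain p q where pq: "p \<in> polyspace I k" "q \<in> polyspace I k"
    and eq: "\<forall>x. f x = f (drop_coord i x) + x $ i * p x" "\<forall>x. g x = g (drop_coord i x) + x $ i * q x" by blast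
  have "f x + g x = f (drop_coord i x) + g (drop_coord i x) + x $ i * (p x + q x)" for x
    using spec[OF eq(1), of x] spec[OF eq(2), of x] by (simp add: distrib_left)
  then show ?case using pq by (intro bexI[of _ "\<lambda>x. p x + q x"] polyspace_add) blast+
next
  case (scale c f)
  then obtain p where p: "p \<in> polyspace I k" "\<forall>x. f x = f (drop_coord i x) + x $ i * p x" by blast
  have "c * f x = c * f (drop_coord i x) + x $ i * (c * p x)" for x
    using arg_cong[OF spec[OF p(2), of x], of "\<lambda>t. c * t"] by (simp add: distrib_left)
  then show ?case
    using p(1) by (intro bexI[of _ "\<lambda>x. c * p x"] polyspace_scale) blast+
next
  case (mon \<alpha>)
  show ?case
  proof (cases "\<alpha> i = 0")
    case True
    then show ?thesis using polyspace_0 by (auto simp: mon_drop_coord intro: bexI[of _ "\<lambda>x. 0"])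
  next
    case False
    define \<beta> where "\<beta> = \<alpha>(i := \<alpha> i - 1)"
    have "sum \<alpha> UNIV = Suc (sum \<beta> UNIV)"
      using False by (simp add: sum.remove[of UNIV i] \<beta>_def)
    moreover have "mon \<alpha> x = x $ i * mon \<beta> x" for x
    proof -
      have "(x $ i) ^ \<alpha> i = x $ i * (x $ i) ^ (\<alpha> i - 1)"
        using False by (metis power_minus_mult mult.commute neq0_conv)
      then show ?thesis by (simp add: mon_split[of _ _ i] \<beta>_def)
    qed
    ultimately show ?thesis using mon False
      by (intro bexI[of _ "mon \<beta>"] mon_in_polyspace) (auto simp: mon_drop_coord \<beta>_def)
  qed
qed

text \<open>On the line through \<open>x\<close> in direction \<open>axis i 1\<close> the coordinate
  vanishes for a single parameter. Elsewhere \<open>q\<close> is zero, hence it is zero on the whole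
  line.\<close>

lemma polyspace_cancel_coord:
  assumes "q \<in> polyspace I k" "\<And>x. x $ i * q x = 0"
  shows "q x = 0"
proof -
  have "UNIV - {- (x $ i)} \<subseteq> {t. q (x + t *\<^sub>R axis i 1) = 0}"
  proof
    fix t assume "t \<in> UNIV - {- (x $ i)}"
    then have "(x + t *\<^sub>R axis i 1) $ i \<noteq> 0" by (simp add: add_eq_0_iff)
    then show "t \<in> {t. q (x + t *\<^sub>R axis i 1) = 0}"
      using assms(2)[of "x + t *\<^sub>R axis i 1"] mult_eq_0_iff by blast
  qed
  moreover have "infinite (UNIV - {- (x $ i)})"
    by (metis Diff_infinite_finite finite.emptyI finite.insertI infinite_UNIV_char_0)
  ultimately have "infinite {t. q (x + t *\<^sub>R axis i 1) = 0}" using infinite_super by blast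
  from polyspace_line_zero[OF assms(1) this, of 0] show ?thesis by simp
qed

text \<open>Multiplication by \<open>x $ i\<close> is an isomorphism from degree \<open>k\<close>
  onto the polynomials of degree \<open>Suc k\<close> vanishing on the hyperplane.\<close>

lemma hasdim_vanish_drop_coord:
  assumes "hasdim (polyspace I k) n" "i \<in> I"
  shows "hasdim {f\<in>polyspace I (Suc k). (\<lambda>x. f (drop_coord i x)) = 0} n"
proof -
  define F where "F = (\<lambda>(q::real^'a \<Rightarrow> real) x. x $ i * q x)"
  have "flinear F" by (auto simp: flinear_def F_def fun_eq_iff algebra_simps)
  moreover have "q = 0" if "q \<in> polyspace I k" "F q = 0" for q
    using polyspace_cancel_coord[OF that(1), of i] that(2) by (auto simp: F_def fun_eq_iff)
  ultimately have "hasdim (F ` polyspace I k) n" by (intro hasdim_inj_image assms)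
  moreover have "F ` polyspace I k = {f\<in>polyspace I (Suc k). (\<lambda>x. f (drop_coord i x)) = 0}"
  proof safe
    fix q assume "q \<in> polyspace I k"
    then show "F q \<in> polyspace I (Suc k)"
      using polyspace_mult[OF polyspace_coord[OF assms(2), of 1]] by (simp add: F_def)
    show "(\<lambda>x. F q (drop_coord i x)) = 0" by (simp add: F_def drop_coord_nth zero_fun_def)
  next
    fix f assume f: "f \<in> polyspace I (Suc k)" "(\<lambda>x. f (drop_coord i x)) = 0"
    obtain q where q: "q \<in> polyspace I k" "\<forall>x. f x = f (drop_coord i x) + x $ i * q x"
      using polyspace_division[OF f(1)] by blast
    have "f x = F q x" for x using spec[OF q(2), of x] fun_cong[OF f(2), of x] by (simp add: F_def)
    then have "f = F q" by (rule ext)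
    then show "f \<in> F ` polyspace I k" using q(1) by simp
  qed
  ultimately show ?thesis by simp
qed

section \<open>Dimensions of polynomial spaces\<close>

lemma flinear_compose: "flinear (\<lambda>f x. f (h x))"
  by (simp add: flinear_def fun_eq_iff)

lemma hasdim_constants: "hasdim (range (\<lambda>(c::real) x::'a. c)) 1"
proof -
  have "FV.span {\<lambda>x::'a. 1::real} = range (\<lambda>c x. c)"
    using FV.span_singleton[of "\<lambda>x::'a. 1::real"] by simp
  moreover have "FV.independent {\<lambda>x::'a. 1::real}"
    by (simp only: FV.dependent_single) (simp add: fun_eq_iff)
  ultimately show ?thesis unfolding hasdim_def by (intro exI[of _ "{\<lambda>x. 1}"]) auto
qed

lemma polyspace_constants: "I = {} \<or> k = 0 \<Longrightarrow> polyspace I k = range (\<lambda>c x. c)"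
proof (intro equalityI subsetI)
  fix f :: "real^'a \<Rightarrow> real" assume *: "I = {} \<or> k = 0" and "f \<in> polyspace I k"
  from this(2) show "f \<in> range (\<lambda>c x. c)"
  proof (induction rule: polyspace_induct)
    case (mon \<alpha>)
    then have "\<alpha> = (\<lambda>_. 0)" using * by (auto simp: fun_eq_iff)
    then show ?case by (simp add: mon_0)
  qed auto
qed (auto simp: polyspace_const)

text \<open>Pascal's rule as rank-nullity: for restriction to the hyperplane of a new variable
  \<open>i\<close>, the kernel is a copy of degree \<open>k\<close> in all the variables and the
  image has degree \<open>Suc k\<close> in the old ones. Hence the nested induction on
  \<open>I\<close> and on \<open>k\<close>.\<close>

lemma hasdim_polyspace:
  fixes I :: "'d::finite set"
  shows "hasdim (polyspace I k) ((k + card I) choose card I)"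
proof -
  have "finite I" by simp
  then show ?thesis
  proof (induction I arbitrary: k rule: finite_induct)
    case empty
    show ?case using hasdim_constants by (simp add: polyspace_constants)
  next
    case (insert i I)
    show ?case
    proof (induction k)
      case 0
      show ?case using hasdim_constants by (simp add: polyspace_constants del: One_nat_def)
    next
      case (Suc k)
      let ?f = "\<lambda>(f::real^'d \<Rightarrow> real) x. f (drop_coord i x)"
      have eq: "insert i I - {i} = I" using insert.hyps by auto
      have im: "?f ` polyspace (insert i I) (Suc k) = polyspace I (Suc k)"
      proof
        show "?f ` polyspace (insert i I) (Suc k) \<subseteq> polyspace I (Suc k)"
          using polyspace_drop_coord[of _ "insert i I" "Suc k" i] eq by auto
        show "polyspace I (Suc k) \<subseteq> ?f ` polyspace (insert i I) (Suc k)"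
        proof
          fix f assume f: "f \<in> polyspace I (Suc k)"
          then have "f = ?f f" using polyspace_drop_coord_id[of f "insert i I" i] eq by (auto simp: fun_eq_iff)
          then show "f \<in> ?f ` polyspace (insert i I) (Suc k)"
            using f polyspace_mono[of I "insert i I" "Suc k" "Suc k"] by (intro image_eqI[of _ _ f]) auto
        qed
      qed
      have "hasdim (polyspace (insert i I) (Suc k))
          (((k + card (insert i I)) choose card (insert i I)) + ((Suc k + card I) choose card I))"
        by (rule hasdim_kernel_image[OF subspace_polyspace flinear_compose[of "drop_coord i"]])
           (use hasdim_vanish_drop_coord[OF Suc.IH, of i] insert.IH[of "Suc k"] in \<open>auto simp: im\<close>)
      then show ?case using insert.hyps by (simp add: add.commute)
    qed
  qed
qed

text \<open>Model case of the coefficients in \<open>Sigma_k\<close>: restriction has the same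
  kernel as on the full space of degree \<open>Suc k\<close>, but its image is cut down to degree
  \<open>k\<close>.\<close>

lemma hasdim_polyspace_face:
  fixes i :: "'a::finite"
  assumes "hasdim (polyspace (UNIV - {i}) k) n" "hasdim (polyspace (UNIV :: 'a set) k) m"
  shows "hasdim {f\<in>polyspace UNIV (Suc k). \<exists>p\<in>polyspace UNIV k. \<forall>x. f (drop_coord i x) = p (drop_coord i x)} (m + n)"
    (is "hasdim ?S _")
proof -
  let ?f = "\<lambda>(f::real^'a \<Rightarrow> real) x. f (drop_coord i x)"
  have sub: "FV.subspace ?S"
  proof (rule FV.subspaceI)
    show "0 \<in> ?S" using polyspace_0 by (auto simp: zero_fun_def)
  next
    fix f g assume "f \<in> ?S" "g \<in> ?S"
    then obtain p q where "p\<in>polyspace UNIV k" "\<forall>x. f (drop_coord i x) = p (drop_coord i x)"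
      "q\<in>polyspace UNIV k" "\<forall>x. g (drop_coord i x) = q (drop_coord i x)"
      "f \<in> polyspace UNIV (Suc k)" "g \<in> polyspace UNIV (Suc k)" by blast
    then show "f + g \<in> ?S" unfolding plus_fun_def
      by (auto intro: polyspace_add intro!: bexI[of _ "\<lambda>x. p x + q x"])
  next
    fix c f assume "f \<in> ?S"
    then obtain p where "p\<in>polyspace UNIV k" "\<forall>x. f (drop_coord i x) = p (drop_coord i x)"
      "f \<in> polyspace UNIV (Suc k)" by blast
    then show "(\<lambda>x. c *\<^sub>R f x) \<in> ?S"
      by (auto intro: polyspace_scale intro!: bexI[of _ "\<lambda>x. c * p x"])
  qed
  have im: "?f ` ?S = polyspace (UNIV - {i}) k"
  proof
    show "?f ` ?S \<subseteq> polyspace (UNIV - {i}) k"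
    proof safe
      fix f p assume "p \<in> polyspace UNIV k" "\<forall>x. f (drop_coord i x) = p (drop_coord i x)"
      then show "(\<lambda>x. f (drop_coord i x)) \<in> polyspace (UNIV - {i}) k"
        using polyspace_drop_coord[of p UNIV k i] by simp
    qed
    show "polyspace (UNIV - {i}) k \<subseteq> ?f ` ?S"
    proof
      fix f assume f: "f \<in> polyspace (UNIV - {i}) k"
      then have "f = ?f f" using polyspace_drop_coord_id[OF f] by auto
      moreover have "f \<in> polyspace UNIV k" "f \<in> polyspace UNIV (Suc k)"
        using f polyspace_mono[of "UNIV - {i}" UNIV k k] polyspace_mono[of "UNIV - {i}" UNIV k "Suc k"] by auto
      ultimately show "f \<in> ?f ` ?S" by (intro image_eqI[of _ _ f]) auto
    qed
  qed
  have "{f\<in>?S. ?f f = 0} = {f\<in>polyspace UNIV (Suc k). ?f f = 0}"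
    using polyspace_0 by (auto simp: fun_eq_iff intro!: bexI[of _ "\<lambda>x. 0"])
  then show ?thesis
    using hasdim_vanish_drop_coord[OF assms(2), of i] assms(1) im
    by (intro hasdim_kernel_image[OF sub flinear_compose[of "drop_coord i"]]) simp_all
qed

section \<open>Polynomials on a facet\<close>

text \<open>Here \<open>\<theta>\<close> is an affine chart that flattens the hyperplane of the
  facet to \<open>x $ i = 0\<close>, with inverse \<open>\<psi>\<close>. Agreement on the compact
  facet is traded for agreement on the whole hyperplane, which \<open>drop_coord\<close> can
  express.\<close>

lemma polyspace_eq_on_facet_iff:
  fixes \<psi> \<theta> :: "real^'d \<Rightarrow> real^'d"
  assumes \<theta>: "\<And>j. (\<lambda>x. \<theta> x $ j) \<in> polyspace UNIV 1"
    and inv: "\<And>x. \<psi> (\<theta> x) = x" "\<And>x. \<theta> (\<psi> x) = x"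
    and W: "finite W" "affine hull W = {x. \<theta> x $ i = 0}"
    and a: "a \<in> polyspace UNIV k" and p: "p \<in> polyspace UNIV k"
  shows "(\<forall>x\<in>convex hull W. a x = p x) \<longleftrightarrow> (\<forall>x. a (\<psi> (drop_coord i x)) = p (\<psi> (drop_coord i x)))"
proof
  assume h: "\<forall>x\<in>convex hull W. a x = p x"
  show "\<forall>x. a (\<psi> (drop_coord i x)) = p (\<psi> (drop_coord i x))"
  proof
    fix x
    have "\<psi> (drop_coord i x) \<in> affine hull W" by (simp add: W(2) inv drop_coord_nth)
    from polyspace_zero_on_affine_hull[OF polyspace_diff[OF a p] W(1) _ this] h
    show "a (\<psi> (drop_coord i x)) = p (\<psi> (drop_coord i x))" by simp
  qed
next
  assume h: "\<forall>x. a (\<psi> (drop_coord i x)) = p (\<psi> (drop_coord i x))"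
  show "\<forall>x\<in>convex hull W. a x = p x"
  proof
    fix x assume "x \<in> convex hull W"
    then have "\<theta> x $ i = 0" using convex_hull_subset_affine_hull[of W] W(2) by auto
    then have "\<psi> (drop_coord i (\<theta> x)) = x" by (simp add: drop_coord_id inv)
    then show "a x = p x" using spec[OF h, of "\<theta> x"] by simp
  qed
qed

text \<open>The coordinate hyperplane results are carried to an arbitrary facet by composition with
  the chart. The number \<open>m\<close> counts multiples of the facet equation, and
  \<open>n\<close> counts polynomials of degree \<open>k\<close> on the facet.\<close>

lemma
  fixes \<psi> \<theta> :: "real^'d \<Rightarrow> real^'d" and k :: nat
  assumes \<theta>: "\<And>j. (\<lambda>x. \<theta> x $ j) \<in> polyspace UNIV 1" and \<psi>: "\<And>j. (\<lambda>x. \<psi> x $ j) \<in> polyspace UNIV 1"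
    and inv: "\<And>x. \<psi> (\<theta> x) = x" "\<And>x. \<theta> (\<psi> x) = x"
    and W: "finite W" "affine hull W = {x. \<theta> x $ i = 0}"
  defines "m \<equiv> (k + CARD('d)) choose CARD('d)"
    and "n \<equiv> (k + (CARD('d) - 1)) choose (CARD('d) - 1)"
  shows hasdim_vanishing_on_facet: "hasdim {a\<in>polyspace UNIV (Suc k). \<forall>x\<in>convex hull W. a x = 0} m"
    and hasdim_lower_degree_on_facet:
      "hasdim {a\<in>polyspace UNIV (Suc k). \<exists>p\<in>polyspace UNIV k. \<forall>x\<in>convex hull W. a x = p x} (m + n)"
    and hasdim_restricted_to_facet:
      "hasdim {\<lambda>x. if x \<in> convex hull W then p x else 0 | p. p \<in> polyspace UNIV k} n"
proof -
  note iff = polyspace_eq_on_facet_iff[OF \<theta> inv W]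
  define C where "C = (\<lambda>(f::real^'d \<Rightarrow> real) x. f (\<theta> x))"
  have C: "flinear C" unfolding C_def by (rule flinear_compose)
  have C0: "f = 0" if "C f = 0" for f
  proof
    fix x show "f x = 0 x" using fun_cong[OF that, of "\<psi> x"] by (simp add: C_def inv)
  qed
  have Cm: "C f \<in> polyspace UNIV j" if "f \<in> polyspace UNIV j" for f j
    unfolding C_def by (rule polyspace_compose[OF that \<theta>])
  have D: "(\<lambda>x. f (\<psi> x)) \<in> polyspace UNIV j" if "f \<in> polyspace UNIV j" for f j
    by (rule polyspace_compose[OF that \<psi>])
  have CD: "f = C (\<lambda>x. f (\<psi> x))" for f by (simp add: C_def inv)
  have Cpsi: "C f (\<psi> y) = f y" for f y by (simp add: C_def inv)
  have up: "f \<in> polyspace UNIV (Suc k)" if "f \<in> polyspace UNIV k" for f :: "real^'d \<Rightarrow> real"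
    using polyspace_mono[of UNIV UNIV k "Suc k"] that by auto
  have m: "hasdim (polyspace (UNIV::'d set) k) m"
    unfolding m_def by (rule hasdim_polyspace)
  have n: "hasdim (polyspace (UNIV - {i}) k) n"
    using hasdim_polyspace[of "UNIV - {i}" k] by (simp add: n_def)
  have "hasdim (C ` {f\<in>polyspace UNIV (Suc k). (\<lambda>x. f (drop_coord i x)) = 0}) m"
    by (rule hasdim_inj_image[OF hasdim_vanish_drop_coord[OF m] C C0]) auto
  moreover have "C ` {f\<in>polyspace UNIV (Suc k). (\<lambda>x. f (drop_coord i x)) = 0}
      = {a\<in>polyspace UNIV (Suc k). \<forall>x\<in>convex hull W. a x = 0}" (is "C ` ?A = ?B")
  proof (intro equalityI subsetI)
    fix a assume "a \<in> C ` ?A"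
    then obtain f where f: "f \<in> polyspace UNIV (Suc k)" "(\<lambda>x. f (drop_coord i x)) = 0" "a = C f" by auto
    have "\<forall>x\<in>convex hull W. a x = 0"
      unfolding iff[OF Cm[OF f(1)] polyspace_0, folded f(3)] using f(2)
      by (simp add: f(3) Cpsi fun_eq_iff)
    then show "a \<in> ?B" using Cm[OF f(1)] f(3) by simp
  next
    fix a assume "a \<in> ?B"
    then have a: "a \<in> polyspace UNIV (Suc k)" "\<forall>x\<in>convex hull W. a x = 0" by auto
    have "\<forall>x. a (\<psi> (drop_coord i x)) = 0" using iff[OF a(1) polyspace_0] a(2) by simp
    then show "a \<in> C ` ?A" using D[OF a(1)]
      by (intro image_eqI[OF CD]) (auto simp: zero_fun_def)
  qed
  ultimately show "hasdim ?B m" by simp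
  have "hasdim (C ` {f\<in>polyspace UNIV (Suc k). \<exists>p\<in>polyspace UNIV k. \<forall>x. f (drop_coord i x) = p (drop_coord i x)}) (m + n)"
    by (rule hasdim_inj_image[OF hasdim_polyspace_face[OF n m] C C0]) auto
  moreover have "C ` {f\<in>polyspace UNIV (Suc k). \<exists>p\<in>polyspace UNIV k. \<forall>x. f (drop_coord i x) = p (drop_coord i x)}
     = {a\<in>polyspace UNIV (Suc k). \<exists>p\<in>polyspace UNIV k. \<forall>x\<in>convex hull W. a x = p x}" (is "C ` ?A = ?B")
  proof (intro equalityI subsetI)
    fix a assume "a \<in> C ` ?A"
    then obtain f p where f: "f \<in> polyspace UNIV (Suc k)" "a = C f"
      and p: "p \<in> polyspace UNIV k" "\<forall>x. f (drop_coord i x) = p (drop_coord i x)" by auto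
    have "\<forall>x\<in>convex hull W. a x = C p x"
      unfolding iff[OF Cm[OF f(1)] Cm[OF up[OF p(1)]], folded f(2)] using p(2)
      by (simp add: f(2) Cpsi)
    then show "a \<in> ?B" using Cm[OF f(1)] Cm[OF p(1)] f(2) by auto
  next
    fix a assume "a \<in> ?B"
    then obtain p where a: "a \<in> polyspace UNIV (Suc k)" and p: "p \<in> polyspace UNIV k"
      "\<forall>x\<in>convex hull W. a x = p x" by auto
    have "\<forall>x. a (\<psi> (drop_coord i x)) = p (\<psi> (drop_coord i x))" using iff[OF a(1) up[OF p(1)]] p(2) by simp
    then show "a \<in> C ` ?A" using D[OF a(1)] D[OF p(1)]
      by (intro image_eqI[OF CD]) auto
  qed
  ultimately show "hasdim ?B (m + n)" by simp
  define R where "R = (\<lambda>(f::real^'d \<Rightarrow> real) x. if x \<in> convex hull W then C f x else 0)"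
  have R: "flinear R" by (auto simp: flinear_def R_def C_def fun_eq_iff)
  have "f = 0" if f: "f \<in> polyspace (UNIV - {i}) k" "R f = 0" for f
  proof -
    have f': "f \<in> polyspace UNIV k" using f(1) polyspace_mono[of "UNIV - {i}" UNIV k k] by auto
    have "\<forall>x\<in>convex hull W. C f x = 0"
      using f(2) by (auto simp: R_def fun_eq_iff split: if_splits)
    then have "\<forall>x. f (drop_coord i x) = 0"
      unfolding iff[OF Cm[OF f'] polyspace_0] by (simp add: Cpsi)
    then show "f = 0" using polyspace_drop_coord_id[OF f(1)] by (simp add: fun_eq_iff)
  qed
  then have "hasdim (R ` polyspace (UNIV - {i}) k) n" by (rule hasdim_inj_image[OF n R])
  moreover have "R ` polyspace (UNIV - {i}) k
     = {\<lambda>x. if x \<in> convex hull W then p x else 0 | p. p \<in> polyspace UNIV k}" (is "R ` ?A = ?B")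
  proof (intro equalityI subsetI)
    fix a assume "a \<in> R ` ?A"
    then obtain f where f: "f \<in> ?A" "a = R f" by auto
    have "C f \<in> polyspace UNIV k" using f(1) polyspace_mono[of "UNIV - {i}" UNIV k k] Cm by auto
    then show "a \<in> ?B" using f(2) unfolding R_def by blast
  next
    fix a assume "a \<in> ?B"
    then obtain p where p: "p \<in> polyspace UNIV k" "a = (\<lambda>x. if x \<in> convex hull W then p x else 0)" by auto
    \<comment> \<open>In chart coordinates \<open>f\<close> takes the facet values of
      \<open>p\<close> and extends them independently of coordinate \<open>i\<close>; this selects
      one representative of each function on the facet.\<close>
    define f where "f = (\<lambda>x. p (\<psi> (drop_coord i x)))"
    have f: "f \<in> ?A" unfolding f_def by (rule polyspace_drop_coord[OF D[OF p(1)]])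
    then have f': "f \<in> polyspace UNIV k" using polyspace_mono[of "UNIV - {i}" UNIV k k] by auto
    have "\<forall>x\<in>convex hull W. C f x = p x"
      unfolding iff[OF Cm[OF f'] p(1)] by (simp add: Cpsi) (simp add: f_def drop_coord_idem)
    then have "a = R f" unfolding p(2) R_def by (simp add: fun_eq_iff)
    then show "a \<in> R ` ?A" using f by blast
  qed
  ultimately show "hasdim ?B n" by simp
qed

text \<open>Coordinate functionals for a basis given as an indexed family. The dimension bound
  replaces a proof that the family spans \<open>S\<close>. It is applied to traceless matrices and
  to tangent vectors of a facet.\<close>

lemma ex_dual_functionals:
  fixes m :: "'j \<Rightarrow> 'm::euclidean_space"
  assumes J: "finite J" and ind: "\<And>c j. (\<Sum>i\<in>J. c i *\<^sub>R m i) = 0 \<Longrightarrow> j \<in> J \<Longrightarrow> c j = 0"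
    and S: "m ` J \<subseteq> S" "dim S \<le> card J"
  shows "\<exists>\<mu> :: 'j \<Rightarrow> 'm \<Rightarrow> real. (\<forall>j. linear (\<mu> j)) \<and>
    (\<forall>i\<in>J. \<forall>j\<in>J. \<mu> i (m j) = (if i = j then 1 else 0)) \<and>
    (\<forall>x\<in>S. x = (\<Sum>j\<in>J. \<mu> j x *\<^sub>R m j))"
proof -
  have inj: "inj_on m J"
  proof (rule inj_onI, rule ccontr)
    fix i j assume ij: "i \<in> J" "j \<in> J" "m i = m j" "i \<noteq> j"
    define c where "c = (\<lambda>l. if l = i then 1 else if l = j then - 1 else (0::real))"
    have "(\<Sum>l\<in>J. c l *\<^sub>R m l) = (\<Sum>l\<in>{i, j}. c l *\<^sub>R m l)"
      by (rule sum.mono_neutral_right) (use J ij in \<open>auto simp: c_def\<close>)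
    also have "\<dots> = 0" using ij by (simp add: c_def)
    finally show False using ind[of c i] ij(1) by (simp add: c_def)
  qed
  have indep: "independent (m ` J)"
  proof (rule independent_if_scalars_zero)
    show "finite (m ` J)" using J by simp
    fix u x assume "(\<Sum>x\<in>m ` J. u x *\<^sub>R x) = 0" "x \<in> m ` J"
    then show "u x = 0" using ind[of "\<lambda>j. u (m j)"] by (auto simp: sum.reindex[OF inj])
  qed
  have "\<exists>g. linear g \<and> (\<forall>x\<in>m ` J. g x = (if x = m i then 1 else (0::real)))" for i
    by (rule linear_independent_extend[OF indep])
  then obtain \<mu> where \<mu>: "\<And>i. linear (\<mu> i)" "\<And>i x. x \<in> m ` J \<Longrightarrow> \<mu> i x = (if x = m i then 1 else (0::real))"
    by metis
  have dual: "\<mu> i (m j) = (if i = j then 1 else 0)" if "i \<in> J" "j \<in> J" for i j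
    using \<mu>(2)[of "m j" i] that inj by (auto simp: inj_on_def)
  have "x = (\<Sum>j\<in>J. \<mu> j x *\<^sub>R m j)"
    if "x \<in> S" for x
  proof -
    have "S \<subseteq> span (m ` J)"
      by (rule card_ge_dim_independent) (use S indep inj in \<open>auto simp: card_image\<close>)
    then have "x \<in> span (m ` J)" using that by auto
    then obtain u where "x = (\<Sum>y\<in>m ` J. u y *\<^sub>R y)"
      using J by (auto simp: span_finite)
    then have x: "x = (\<Sum>j\<in>J. u (m j) *\<^sub>R m j)" by (simp add: sum.reindex[OF inj])
    have "\<mu> i x = u (m i)" if "i \<in> J" for i
    proof -
      have "\<mu> i x = (\<Sum>j\<in>J. u (m j) * (if i = j then 1 else 0))"
        unfolding x using that by (simp add: linear_sum[OF \<mu>(1)] linear_scale[OF \<mu>(1)] dual)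
      then show ?thesis using J that by (simp add: if_distrib[where f = "\<lambda>t. _ * t"] cong: if_cong)
    qed
    then show ?thesis using x by simp
  qed
  then show ?thesis using \<mu>(1) dual by (intro exI[of _ \<mu>]) blast
qed

section \<open>Polynomial fields with vector or matrix values\<close>

definition polyval :: "nat \<Rightarrow> (real^'d \<Rightarrow> 'b::euclidean_space) \<Rightarrow> bool" where
  "polyval k f \<longleftrightarrow> (\<forall>b\<in>Basis. (\<lambda>x. f x \<bullet> b) \<in> polyspace UNIV k)"

lemma polyvec_iff_polyval: "polyvec k f \<longleftrightarrow> polyval k f"
  unfolding polyvec_def polyval_def polyfun_iff_polyspace by (simp add: Basis_vec_def inner_axis)

lemma polymat_iff_polyval: "polymat k f \<longleftrightarrow> polyval k f"
  unfolding polymat_def polyval_def polyfun_iff_polyspace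
  by (simp add: Basis_vec_def inner_axis)

lemma polyval_linear:
  assumes "polyval k f" "linear l"
  shows "(\<lambda>x. l (f x)) \<in> polyspace UNIV k"
proof -
  have "l (f x) = (\<Sum>b\<in>Basis. l b * (f x \<bullet> b))" for x
  proof -
    have "l (f x) = l (\<Sum>b\<in>Basis. (f x \<bullet> b) *\<^sub>R b)" by (simp add: euclidean_representation)
    then show ?thesis by (simp add: linear_sum[OF assms(2)] linear_scale[OF assms(2)] mult.commute)
  qed
  then show ?thesis
    using assms(1) by (auto simp: polyval_def intro!: polyspace_sum polyspace_scale)
qed

lemma polyval_linear_image:
  assumes "polyval k f" "linear l"
  shows "polyval k (\<lambda>x. l (f x))"
  unfolding polyval_def
proof
  fix b :: 'c
  have "linear (\<lambda>y. l y \<bullet> b)"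
    by (intro linearI) (simp_all add: linear_add[OF assms(2)] linear_scale[OF assms(2)] inner_left_distrib)
  then show "(\<lambda>x. l (f x) \<bullet> b) \<in> polyspace UNIV k" by (rule polyval_linear[OF assms(1)])
qed

lemma polyval_combination:
  "(\<And>j. j \<in> J \<Longrightarrow> a j \<in> polyspace UNIV k) \<Longrightarrow> polyval k (\<lambda>x. \<Sum>j\<in>J. a j x *\<^sub>R m j)"
  unfolding polyval_def inner_sum_left inner_scaleR_left
  by (subst mult.commute) (intro ballI polyspace_sum polyspace_scale)

lemma polyval_compose:
  assumes "polyval k f" "\<And>i. (\<lambda>x. \<psi> x $ i) \<in> polyspace UNIV 1"
  shows "polyval k (\<lambda>x. f (\<psi> x))"
  unfolding polyval_def
proof
  fix b :: 'b assume "b \<in> Basis"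
  then have "(\<lambda>x. f x \<bullet> b) \<in> polyspace UNIV k" using assms(1) by (simp add: polyval_def)
  then show "(\<lambda>x. f (\<psi> x) \<bullet> b) \<in> polyspace UNIV k" by (rule polyspace_compose[OF _ assms(2)])
qed

lemma polyval_continuous:
  assumes "polyval k f"
  shows "continuous_on S f"
  unfolding continuous_on_componentwise[of S f]
proof
  fix b :: 'b assume "b \<in> Basis"
  then have "(\<lambda>x. f x \<bullet> b) \<in> polyspace UNIV k" using assms by (simp add: polyval_def)
  then show "continuous_on S (\<lambda>x. f x \<bullet> b)" by (rule polyspace_continuous)
qed

lemma polyval_zero_on_affine_hull:
  assumes "polyval k f" "finite W" "\<And>x. x \<in> convex hull W \<Longrightarrow> f x = 0" "x \<in> affine hull W"
  shows "f x = 0"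
proof (rule euclidean_eqI)
  fix b :: 'b assume "b \<in> Basis"
  then show "f x \<bullet> b = 0 \<bullet> b"
    using polyspace_zero_on_affine_hull[OF _ assms(2) _ assms(4), of "\<lambda>x. f x \<bullet> b"] assms(1,3)
    by (auto simp: polyval_def)
qed

section \<open>Traceless matrices and normal-tangential traces\<close>

lemma sum_UNIV_option: "(\<Sum>v\<in>UNIV. f v) = f None + (\<Sum>i\<in>(UNIV::'d::finite set). f (Some i))"
  by (simp add: UNIV_option_conv sum.reindex)

lemma linear_matrix_vector_mult_left: "linear (\<lambda>X. X *v (z :: real^'d))"
  by (rule linearI) (simp_all add: matrix_vector_mult_add_rdistrib scaleR_matrix_vector_assoc)

text \<open>The operator \<open>nt\<close> acts pointwise. Separating the matrix from the field
  exposes its linearity in the matrix.\<close>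

definition ntl :: "real^'d \<Rightarrow> real^'d^'d \<Rightarrow> real^'d" where
  "ntl n X = X *v n - (n \<bullet> (X *v n)) *\<^sub>R n"

lemma nt_eq_ntl: "nt \<tau> n x = ntl n (\<tau> x)"
  by (simp add: nt_def ntl_def)

lemma linear_ntl: "linear (ntl n)"
  by (rule linearI)
     (simp_all add: ntl_def linear_add[OF linear_matrix_vector_mult_left]
       linear_scale[OF linear_matrix_vector_mult_left] inner_right_distrib
       scaleR_left_distrib scaleR_diff_right)

lemma trace_scaleR: "trace (c *\<^sub>R X) = c * trace (X :: real^'d^'d)"
  by (simp add: trace_def sum_distrib_left)

lemma linear_trace: "linear (trace :: real^'d^'d \<Rightarrow> real)"
  by (rule linearI) (simp_all add: trace_add trace_scaleR)

lemma subspace_traceless: "subspace {X :: real^'d^'d. trace X = 0}"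
  by (rule subspaceI) (simp_all add: trace_add trace_scaleR linear_0[OF linear_trace])

text \<open>The identity matrix has nonzero trace, so the subspace is proper. The upper bound is
  enough, because the independent family \<open>MJ\<close> attains it.\<close>

lemma dim_traceless_le: "dim {X :: real^'d^'d. trace X = 0} \<le> CARD('d) * CARD('d) - 1"
proof -
  let ?D = "{X :: real^'d^'d. trace X = 0}"
  have "mat 1 \<notin> ?D" by (simp add: trace_I)
  then have "?D \<subset> UNIV" by blast
  moreover have "span ?D = ?D" using subspace_traceless by (simp only: span_eq_iff)
  ultimately have "dim ?D < dim (UNIV :: (real^'d^'d) set)"
    using dim_psubset[of ?D UNIV] by (simp only: span_UNIV)
  then show ?thesis by simp
qed

lemma polyspace_affine: "(\<lambda>x. (X *v x + c) $ j) \<in> polyspace UNIV 1"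
proof -
  have "(\<lambda>x. (\<Sum>i\<in>UNIV. X $ j $ i * x $ i) + c $ j) \<in> polyspace UNIV 1"
    by (intro polyspace_add polyspace_sum polyspace_scale polyspace_coord polyspace_const) auto
  then show ?thesis by (simp add: matrix_vector_mult_def)
qed

text \<open>The simplex is the image of the reference simplex under \<open>y \<mapsto> A y + b\<close>; its vertices are indexed
  by \<^typ>\<open>'d option\<close>, where \<^term>\<open>None\<close> stands for the image of the origin.\<close>

locale simplex_frame =
  fixes A B :: "real^'d^'d" and b :: "real^'d"
  assumes AB: "A ** B = mat 1" and BA: "B ** A = mat 1"
begin

definition vert :: "'d option \<Rightarrow> real^'d" where
  "vert v = (case v of None \<Rightarrow> b | Some i \<Rightarrow> b + A *v axis i 1)"

text \<open>The barycentric coordinates, read off from the coordinates of the preimage in the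
  reference simplex.\<close>

definition lam :: "'d option \<Rightarrow> real^'d \<Rightarrow> real" where
  "lam v x = (case v of None \<Rightarrow> 1 - (\<Sum>i\<in>UNIV. (B *v (x - b)) $ i) | Some i \<Rightarrow> (B *v (x - b)) $ i)"

text \<open>The constant gradients of the barycentric coordinates: the rows of \<open>B\<close>, and
  minus their sum because the coordinates add up to 1. So \<open>g v\<close> is orthogonal to the
  facet opposite \<open>v\<close>.\<close>

definition g :: "'d option \<Rightarrow> real^'d" where
  "g v = (case v of None \<Rightarrow> - (\<Sum>i\<in>UNIV. B $ i) | Some i \<Rightarrow> B $ i)"

lemma A_B_vec: "A *v (B *v x) = x" and B_A_vec: "B *v (A *v x) = x"
  by (simp_all add: matrix_vector_mul_assoc AB BA)

lemma lam_diff: "lam v x - lam v y = g v \<bullet> (x - y)"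
proof (cases v)
  case None
  have "(\<Sum>i\<in>UNIV. (B *v (y - b)) $ i) - (\<Sum>i\<in>UNIV. (B *v (x - b)) $ i) = - (\<Sum>i\<in>UNIV. B $ i \<bullet> (x - y))"
    unfolding sum_subtractf[symmetric] sum_negf[symmetric]
    by (rule sum.cong) (simp_all add: matrix_vector_mul_component inner_diff_right)
  then show ?thesis using None by (simp add: lam_def g_def inner_sum_left)
next
  case (Some i)
  then show ?thesis by (simp add: lam_def g_def matrix_vector_mul_component inner_diff_right)
qed

lemma sum_lam: "(\<Sum>v\<in>UNIV. lam v x) = 1"
  by (simp add: sum_UNIV_option lam_def)

lemma sum_lam_vert: "(\<Sum>v\<in>UNIV. lam v x *\<^sub>R vert v) = x"
proof -
  have "(\<Sum>i\<in>UNIV. (B *v (x - b)) $ i *\<^sub>R (A *v axis i 1)) = A *v (B *v (x - b))"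
    by (subst (2) matrix_mult_sum) (simp add: matrix_vector_mult_basis scalar_mult_eq_scaleR)
  also have "\<dots> = x - b" by (rule A_B_vec)
  finally show ?thesis
    by (simp add: sum_UNIV_option lam_def vert_def scaleR_add_right sum.distrib
        scaleR_sum_left[symmetric] scaleR_left_diff_distrib)
qed

lemma lam_vert: "lam v (vert u) = (if u = v then 1 else 0)"
proof -
  have ax: "(axis i 1 :: real^'d) $ j = (if j = i then 1 else 0)" for i j by (simp add: axis_def)
  show ?thesis
    by (cases u; cases v) (auto simp: lam_def vert_def B_A_vec ax)
qed

lemma inj_vert: "inj vert"
proof (rule injI, rule ccontr)
  fix u v assume "vert u = vert v" "u \<noteq> v"
  then show False using lam_vert[of u u] lam_vert[of u v] by simp
qed

lemma g_vert: "g v \<bullet> (vert u - vert w) = (if u = v then 1 else 0) - (if w = v then 1 else 0)"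
  using lam_diff[of v "vert u" "vert w"] by (simp add: lam_vert)

lemma sum_g: "(\<Sum>v\<in>UNIV. g v) = 0"
  by (simp add: sum_UNIV_option g_def)

text \<open>Differences of the barycentric representation give
  \<open>x = (\<Sum>v\<in>UNIV. (g v \<bullet> x) *\<^sub>R vert v)\<close>; the transpose of this
  identity expands \<open>n\<close> in gradients. The shift by \<open>p\<close> is free since the
  gradients sum to zero. If \<open>n\<close> is normal to a facet and \<open>p\<close> lies on it,
  one term survives.\<close>

lemma g_expansion: "n = (\<Sum>v\<in>UNIV. ((vert v - p) \<bullet> n) *\<^sub>R g v)"
proof -
  have x: "x = (\<Sum>v\<in>UNIV. (g v \<bullet> x) *\<^sub>R vert v)" for x
  proof -
    have "x = (\<Sum>v\<in>UNIV. lam v x *\<^sub>R vert v) - (\<Sum>v\<in>UNIV. lam v 0 *\<^sub>R vert v)"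
      by (simp add: sum_lam_vert)
    also have "\<dots> = (\<Sum>v\<in>UNIV. (g v \<bullet> x) *\<^sub>R vert v)"
      unfolding sum_subtractf[symmetric] scaleR_left_diff_distrib[symmetric] lam_diff by simp
    finally show ?thesis .
  qed
  have "(\<Sum>v\<in>UNIV. ((vert v - p) \<bullet> n) *\<^sub>R g v) = (\<Sum>v\<in>UNIV. (vert v \<bullet> n) *\<^sub>R g v) - (p \<bullet> n) *\<^sub>R (\<Sum>v\<in>UNIV. g v)"
    by (simp add: inner_diff_left scaleR_left_diff_distrib sum_subtractf scaleR_sum_right)
  moreover have "\<forall>x. x \<bullet> (\<Sum>v\<in>UNIV. (vert v \<bullet> n) *\<^sub>R g v) = x \<bullet> n"
  proof
    fix x
    have "x \<bullet> n = (\<Sum>v\<in>UNIV. (g v \<bullet> x) *\<^sub>R vert v) \<bullet> n"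
      by (rule arg_cong[OF x])
    then show "x \<bullet> (\<Sum>v\<in>UNIV. (vert v \<bullet> n) *\<^sub>R g v) = x \<bullet> n"
      by (simp add: inner_sum_left inner_sum_right inner_commute mult.commute)
  qed
  then have "(\<Sum>v\<in>UNIV. (vert v \<bullet> n) *\<^sub>R g v) = n" by (simp only: vector_eq_ldot)
  ultimately show ?thesis by (simp add: sum_g)
qed

definition W :: "'d option \<Rightarrow> (real^'d) set" where
  "W w = vert ` (- {w})"

lemma range_minus_vert: "range vert - {vert w} = W w"
  using inj_vert by (auto simp: W_def inj_def)

lemma finite_W: "finite (W w)"
  by (simp add: W_def)

text \<open>An arbitrary vertex different from \<open>w\<close>: the vertex \<open>u(w)\<close> of the introduction.\<close>

definition other :: "'d option \<Rightarrow> 'd option" where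
  "other w = (case w of None \<Rightarrow> Some undefined | Some _ \<Rightarrow> None)"

lemma other_neq: "other w \<noteq> w" "w \<noteq> other w"
  by (auto simp: other_def split: option.splits)

lemma affine_hull_W: "affine hull (W w) = {x. lam w x = 0}"
proof
  have "lam w x = 0 \<longleftrightarrow> g w \<bullet> x = - lam w 0" for x
    using lam_diff[of w x 0] by auto
  then have "{x. lam w x = 0} = {x. g w \<bullet> x = - lam w 0}" by blast
  then have "affine {x. lam w x = 0}" by (simp add: affine_hyperplane)
  then show "affine hull (W w) \<subseteq> {x. lam w x = 0}"
    by (intro hull_minimal) (auto simp: W_def lam_vert)
  show "{x. lam w x = 0} \<subseteq> affine hull (W w)"
  proof
    fix x assume "x \<in> {x. lam w x = 0}"
    then have x: "lam w x = 0" by simp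
    have inj: "inj_on vert (- {w})" using inj_vert inj_on_subset by blast
    define u where "u = (\<lambda>y. lam (inv vert y) x)"
    have "(\<Sum>v\<in>- {w}. lam v x) = 1"
      using sum_lam[of x] x by (simp add: sum.remove[of UNIV w] Compl_eq_Diff_UNIV)
    then have "sum u (W w) = 1"
      by (simp add: W_def u_def sum.reindex[OF inj] inv_f_f[OF inj_vert])
    moreover have "(\<Sum>v\<in>- {w}. lam v x *\<^sub>R vert v) = x"
      using sum_lam_vert[of x] x by (simp add: sum.remove[of UNIV w] Compl_eq_Diff_UNIV)
    then have "(\<Sum>y\<in>W w. u y *\<^sub>R y) = x"
      by (simp add: W_def u_def sum.reindex[OF inj] inv_f_f[OF inj_vert])
    ultimately show "x \<in> affine hull (W w)"
      by (auto simp: affine_hull_finite[OF finite_W])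
  qed
qed

definition N :: "'d option \<Rightarrow> real^'d" where
  "N w = facet_normal (W w)"

text \<open>\<open>facet_normal\<close> is a choice, so only its specification can be used; the
  normalised gradient \<open>g w\<close> shows that the specification is satisfiable.\<close>

lemma N_props: "norm (N w) = 1" "x \<in> W w \<Longrightarrow> y \<in> W w \<Longrightarrow> N w \<bullet> (x - y) = 0"
proof -
  have "g w \<bullet> (vert w - vert (other w)) = 1" using g_vert other_neq by simp
  then have "g w \<noteq> 0" by auto
  then have "norm (g w /\<^sub>R norm (g w)) = 1 \<and> (\<forall>x\<in>W w. \<forall>y\<in>W w. (g w /\<^sub>R norm (g w)) \<bullet> (x - y) = 0)"
    by (auto simp: W_def g_vert)
  then have "norm (N w) = 1 \<and> (\<forall>x\<in>W w. \<forall>y\<in>W w. N w \<bullet> (x - y) = 0)"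
    unfolding N_def facet_normal_def by (rule someI)
  then show "norm (N w) = 1" "x \<in> W w \<Longrightarrow> y \<in> W w \<Longrightarrow> N w \<bullet> (x - y) = 0" by auto
qed

text \<open>Expanding \<open>N w\<close> in gradients, based at a vertex of the facet, leaves the
  term of \<open>w\<close> alone. The sign of the chosen normal stays open.\<close>

lemma N_parallel: obtains s where "s \<noteq> 0" "N w = s *\<^sub>R g w"
proof -
  let ?u = "other w"
  have "N w = (\<Sum>v\<in>UNIV. ((vert v - vert ?u) \<bullet> N w) *\<^sub>R g v)" by (rule g_expansion)
  also have "\<dots> = (\<Sum>v\<in>{w}. ((vert v - vert ?u) \<bullet> N w) *\<^sub>R g v)"
  proof (rule sum.mono_neutral_right)
    have "(vert v - vert ?u) \<bullet> N w = 0" if "v \<noteq> w" for v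
      unfolding inner_commute[of _ "N w"]
      by (rule N_props(2)) (use that other_neq in \<open>auto simp: W_def\<close>)
    then show "\<forall>v\<in>UNIV - {w}. ((vert v - vert ?u) \<bullet> N w) *\<^sub>R g v = 0" by auto
  qed auto
  finally have "N w = ((vert w - vert ?u) \<bullet> N w) *\<^sub>R g w" by simp
  moreover have "N w \<noteq> 0" using N_props(1)[of w] by auto
  ultimately show ?thesis using that by (metis scaleR_zero_left)
qed

text \<open>Being an eigenvector does not depend on length or sign, so the unspecified unit normal
  can be exchanged for the explicit gradient \<open>g w\<close>.\<close>

lemma ntl_zero_iff: "ntl (N w) X = 0 \<longleftrightarrow> (\<exists>c. X *v g w = c *\<^sub>R g w)"
proof
  obtain s where s: "s \<noteq> 0" "N w = s *\<^sub>R g w" by (rule N_parallel)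
  assume "ntl (N w) X = 0"
  then obtain c where "X *v N w = c *\<^sub>R N w" by (auto simp: ntl_def)
  then have "s *\<^sub>R (X *v g w) = s *\<^sub>R (c *\<^sub>R g w)"
    by (simp add: s(2) matrix_vector_mult_scaleR mult.commute)
  then have "X *v g w = c *\<^sub>R g w" using s(1) by (simp only: scaleR_cancel_left) simp
  then show "\<exists>c. X *v g w = c *\<^sub>R g w" by blast
next
  obtain s where s: "s \<noteq> 0" "N w = s *\<^sub>R g w" by (rule N_parallel)
  assume "\<exists>c. X *v g w = c *\<^sub>R g w"
  then obtain c where "X *v g w = c *\<^sub>R g w" by blast
  then have "X *v N w = c *\<^sub>R N w" by (simp add: s(2) matrix_vector_mult_scaleR mult.commute)
  moreover have "N w \<bullet> N w = 1" using N_props(1)[of w] by (simp add: norm_eq_1)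
  ultimately show "ntl (N w) X = 0" by (simp add: ntl_def)
qed

section \<open>A basis of traceless matrices adapted to the facets\<close>

definition E :: "'d option \<Rightarrow> 'd option \<Rightarrow> real^'d^'d" where
  "E w v = (\<chi> i j. g v $ i * (vert v - vert w) $ j)"

lemma E_vec: "E w v *v z = ((vert v - vert w) \<bullet> z) *\<^sub>R g v"
  by (simp add: vec_eq_iff matrix_vector_mult_def E_def inner_vec_def sum_distrib_left sum_distrib_right
      mult.assoc mult.commute mult.left_commute)

lemma trace_E: "w \<noteq> v \<Longrightarrow> trace (E w v) = 1"
  using g_vert[of v v w] by (simp add: trace_def E_def inner_vec_def)

definition M :: "'d option \<Rightarrow> 'd option \<Rightarrow> real^'d^'d" where
  "M w v = E w v - E w (other w)"

definition Jw :: "'d option \<Rightarrow> 'd option set" where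
  "Jw w = {v. v \<noteq> w \<and> v \<noteq> other w}"

lemma card_Jw: "card (Jw w) = CARD('d) - 1"
proof -
  have "Jw w = UNIV - {w, other w}" by (auto simp: Jw_def)
  then have "card (Jw w) = CARD('d option) - 2"
    using other_neq[of w] by (simp add: card_Diff_subset)
  then show ?thesis by (simp add: card_UNIV_option)
qed

definition J :: "('d option \<times> 'd option) set" where
  "J = Sigma UNIV Jw"

lemma card_J: "card J = (CARD('d) + 1) * (CARD('d) - 1)"
  by (simp add: J_def card_Jw card_UNIV_option)

lemma trace_M: "v \<in> Jw w \<Longrightarrow> trace (M w v) = 0"
  using other_neq[of w] by (auto simp: M_def Jw_def trace_sub trace_E)

lemma M_g: "v \<in> Jw w \<Longrightarrow> M w v *v g w = g (other w) - g v"
  using other_neq[of w]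
  by (auto simp: M_def Jw_def matrix_vector_mult_diff_rdistrib E_vec inner_commute[of _ "g w"] g_vert)

text \<open>For \<open>u \<noteq> w\<close> the number
  \<open>g u \<bullet> (vert v - vert w)\<close> is 1 if \<open>v = u\<close> and 0 otherwise. So
  both rank-one parts of \<open>M w v\<close> map \<open>g u\<close> to itself or to zero.\<close>

lemma ntl_M_other:
  assumes "v \<in> Jw w" "u \<noteq> w"
  shows "ntl (N u) (M w v) = 0"
proof -
  have "M w v *v g u = (if u = v then 1 else if u = other w then - 1 else 0) *\<^sub>R g u"
    using assms other_neq[of w]
    by (auto simp: M_def Jw_def matrix_vector_mult_diff_rdistrib E_vec inner_commute[of _ "g u"] g_vert)
  then show ?thesis unfolding ntl_zero_iff by blast
qed

text \<open>The traces of the basis matrices of \<open>w\<close> on their own facet. They form a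
  basis of its tangent space.\<close>

definition m :: "'d option \<Rightarrow> 'd option \<Rightarrow> real^'d" where
  "m w v = ntl (N w) (M w v)"

text \<open>A combination with zero trace has \<open>g w\<close> as an eigenvector, with eigenvalue
  \<open>\<mu>\<close> say. Pairing this equation with the edge from \<open>w\<close> to
  \<open>t\<close> in \<open>Jw w\<close> gives \<open>c t = \<mu>\<close>, and pairing it with the
  edge to \<open>other w\<close> says that the coefficients sum to \<open>- \<mu>\<close>. Hence
  \<open>(card (Jw w) + 1) * \<mu> = 0\<close>.\<close>

lemma m_independent:
  assumes z: "(\<Sum>v\<in>Jw w. c v *\<^sub>R m w v) = 0" and u: "u \<in> Jw w"
  shows "c u = 0"
proof -
  let ?X = "\<Sum>v\<in>Jw w. c v *\<^sub>R M w v"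
  have "ntl (N w) ?X = 0"
    using z by (simp add: m_def linear_sum[OF linear_ntl] linear_scale[OF linear_ntl])
  then obtain \<mu> where \<mu>: "?X *v g w = \<mu> *\<^sub>R g w" unfolding ntl_zero_iff by blast
  have "?X *v g w = (\<Sum>v\<in>Jw w. c v *\<^sub>R (M w v *v g w))"
    using linear_sum[OF linear_matrix_vector_mult_left[of "g w"]]
    by (simp add: scaleR_matrix_vector_assoc)
  then have X: "(\<Sum>v\<in>Jw w. c v *\<^sub>R (g (other w) - g v)) = \<mu> *\<^sub>R g w"
    using \<mu> by (simp add: M_g)
  have dot: "(\<Sum>v\<in>Jw w. c v * ((g (other w) - g v) \<bullet> (vert t - vert w))) = \<mu> * (g w \<bullet> (vert t - vert w))" for t
    using arg_cong[OF X, of "\<lambda>y. y \<bullet> (vert t - vert w)"] by (simp add: inner_sum_left)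
  have c: "c t = \<mu>" if t: "t \<in> Jw w" for t
  proof -
    have "(\<Sum>v\<in>Jw w. c v * ((g (other w) - g v) \<bullet> (vert t - vert w))) = (\<Sum>v\<in>Jw w. if v = t then - c v else 0)"
      by (rule sum.cong) (use t other_neq[of w] in \<open>auto simp: inner_diff_left g_vert Jw_def\<close>)
    then have "- c t = \<mu> * (g w \<bullet> (vert t - vert w))" using dot[of t] t by simp
    then show ?thesis using t by (auto simp: g_vert Jw_def)
  qed
  have "(\<Sum>v\<in>Jw w. c v * ((g (other w) - g v) \<bullet> (vert (other w) - vert w))) = (\<Sum>v\<in>Jw w. \<mu>)"
    by (rule sum.cong) (use c other_neq[of w] in \<open>auto simp: inner_diff_left g_vert Jw_def\<close>)
  then have "real (card (Jw w)) * \<mu> = - \<mu>"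
    using dot[of "other w"] other_neq[of w] by (simp add: g_vert)
  then have "(real (card (Jw w)) + 1) * \<mu> = 0" by (simp add: algebra_simps)
  moreover have "real (card (Jw w)) + 1 \<noteq> 0" by (metis add.commute of_nat_Suc of_nat_neq_0)
  ultimately show ?thesis using c[OF u] by simp
qed

abbreviation MJ :: "'d option \<times> 'd option \<Rightarrow> real^'d^'d" where
  "MJ j \<equiv> M (fst j) (snd j)"

lemma ntl_sum_MJ: "ntl (N w) (\<Sum>j\<in>J. c j *\<^sub>R MJ j) = (\<Sum>v\<in>Jw w. c (w, v) *\<^sub>R m w v)"
proof -
  have "ntl (N w) (\<Sum>j\<in>J. c j *\<^sub>R MJ j) = (\<Sum>j\<in>J. c j *\<^sub>R ntl (N w) (MJ j))"
    by (simp add: linear_sum[OF linear_ntl] linear_scale[OF linear_ntl])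
  also have "\<dots> = (\<Sum>j\<in>Pair w ` Jw w. c j *\<^sub>R ntl (N w) (MJ j))"
  proof (rule sum.mono_neutral_right)
    show "\<forall>j\<in>J - Pair w ` Jw w. c j *\<^sub>R ntl (N w) (MJ j) = 0"
    proof
      fix j assume "j \<in> J - Pair w ` Jw w"
      then have "snd j \<in> Jw (fst j)" "w \<noteq> fst j" by (auto simp: J_def)
      then show "c j *\<^sub>R ntl (N w) (MJ j) = 0" by (simp add: ntl_M_other)
    qed
  qed (auto simp: J_def)
  also have "\<dots> = (\<Sum>v\<in>Jw w. c (w, v) *\<^sub>R m w v)"
    by (subst sum.reindex) (auto simp: inj_on_def m_def)
  finally show ?thesis .
qed

lemma MJ_independent:
  assumes "(\<Sum>j\<in>J. c j *\<^sub>R MJ j) = 0" "j \<in> J"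
  shows "c j = 0"
proof -
  obtain w v where j: "j = (w, v)" "v \<in> Jw w" using assms(2) by (auto simp: J_def)
  have "(\<Sum>v\<in>Jw w. c (w, v) *\<^sub>R m w v) = 0"
    using ntl_sum_MJ[of w c] assms(1) linear_0[OF linear_ntl[of "N w"]] by simp
  then show ?thesis using m_independent[of "\<lambda>v. c (w, v)" w v] j by simp
qed

lemma matrix_functionals:
  "\<exists>\<mu> :: _ \<Rightarrow> _ \<Rightarrow> real. (\<forall>j. linear (\<mu> j)) \<and>
    (\<forall>i\<in>J. \<forall>j\<in>J. \<mu> i (MJ j) = (if i = j then 1 else 0)) \<and>
    (\<forall>X\<in>{X. trace X = 0}. X = (\<Sum>j\<in>J. \<mu> j X *\<^sub>R MJ j))"
proof (rule ex_dual_functionals)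
  show "c j = 0" if "(\<Sum>i\<in>J. c i *\<^sub>R MJ i) = 0" "j \<in> J" for c j
    using that by (rule MJ_independent)
  have "CARD('d) * CARD('d) - 1 = (CARD('d) + 1) * (CARD('d) - 1)"
    by (simp add: algebra_simps diff_mult_distrib2)
  then show "dim {X :: real^'d^'d. trace X = 0} \<le> card J"
    using dim_traceless_le[where 'd = 'd] by (simp add: card_J)
qed (auto simp: trace_M J_def)

lemma vector_functionals:
  "\<exists>\<mu> :: _ \<Rightarrow> _ \<Rightarrow> real. (\<forall>v. linear (\<mu> v)) \<and>
    (\<forall>u\<in>Jw w. \<forall>v\<in>Jw w. \<mu> u (m w v) = (if u = v then 1 else 0)) \<and>
    (\<forall>r\<in>{r. N w \<bullet> r = 0}. r = (\<Sum>v\<in>Jw w. \<mu> v r *\<^sub>R m w v))"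
proof (rule ex_dual_functionals)
  have N1: "N w \<bullet> N w = 1" "N w \<noteq> 0" using N_props(1)[of w] by (auto simp: norm_eq_1)
  show "c j = 0" if "(\<Sum>i\<in>Jw w. c i *\<^sub>R m w i) = 0" "j \<in> Jw w" for c j
    using that by (rule m_independent)
  show "dim {r. N w \<bullet> r = 0} \<le> card (Jw w)"
    using dim_hyperplane[OF N1(2)] by (simp add: card_Jw)
  show "m w ` Jw w \<subseteq> {r. N w \<bullet> r = 0}"
    using N1 by (auto simp: m_def ntl_def inner_diff_right)
qed simp

text \<open>Supplies the charts for the dimension counts on facets. In reference coordinates every
  facet except the one opposite the origin is already a coordinate hyperplane.\<close>

lemma facet_chart:
  obtains \<theta> \<psi> :: "real^'d \<Rightarrow> real^'d" and i where
    "\<forall>j. (\<lambda>x. \<theta> x $ j) \<in> polyspace UNIV 1" "\<forall>j. (\<lambda>x. \<psi> x $ j) \<in> polyspace UNIV 1"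
    "\<forall>x. \<psi> (\<theta> x) = x" "\<forall>x. \<theta> (\<psi> x) = x" "affine hull (W w) = {x. \<theta> x $ i = 0}"
proof -
  define \<psi> \<theta> where "\<psi> = (\<lambda>y. A *v y + b)" and "\<theta> = (\<lambda>x. B *v (x - b))"
  have \<psi>: "(\<lambda>x. \<psi> x $ j) \<in> polyspace UNIV 1" for j
    unfolding \<psi>_def by (rule polyspace_affine)
  have \<theta>: "(\<lambda>x. \<theta> x $ j) \<in> polyspace UNIV 1" for j
    using polyspace_affine[of B "- (B *v b)" j] by (simp add: \<theta>_def matrix_vector_mult_diff_distrib)
  have inv: "\<psi> (\<theta> x) = x" "\<theta> (\<psi> x) = x" for x
    by (simp_all add: \<psi>_def \<theta>_def A_B_vec B_A_vec)
  show ?thesis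
  proof (cases w)
    case (Some i)
    then show ?thesis
      using that[of \<theta> \<psi> i] \<theta> \<psi> inv by (simp add: affine_hull_W lam_def \<theta>_def)
  next
    case None
    \<comment> \<open>Any coordinate serves. The map \<open>\<sigma>\<close> below exchanges the
      barycentric coordinates of the origin and of vertex \<open>i\<close>; it is an involution and
      flattens the oblique facet.\<close>
    define i :: 'd where "i = undefined"
    define \<sigma> :: "real^'d \<Rightarrow> real^'d" where "\<sigma> = (\<lambda>y. \<chi> j. if j = i then 1 - (\<Sum>l\<in>UNIV. y $ l) else y $ j)"
    have \<sigma>\<sigma>: "\<sigma> (\<sigma> y) = y" for y
    proof -
      have "(\<Sum>l\<in>UNIV. \<sigma> y $ l) = \<sigma> y $ i + (\<Sum>l\<in>UNIV - {i}. \<sigma> y $ l)"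
        by (rule sum.remove) auto
      also have "(\<Sum>l\<in>UNIV - {i}. \<sigma> y $ l) = (\<Sum>l\<in>UNIV - {i}. y $ l)"
        by (rule sum.cong) (auto simp: \<sigma>_def)
      also have "\<dots> = (\<Sum>l\<in>UNIV. y $ l) - y $ i" by (simp add: sum_diff1)
      finally have "(\<Sum>l\<in>UNIV. \<sigma> y $ l) = 1 - y $ i" by (simp add: \<sigma>_def)
      moreover have "\<sigma> (\<sigma> y) $ j = (if j = i then 1 - (\<Sum>l\<in>UNIV. \<sigma> y $ l) else y $ j)" for j
        by (simp add: \<sigma>_def)
      ultimately show ?thesis by (simp add: vec_eq_iff)
    qed
    have \<sigma>: "(\<lambda>x. \<sigma> x $ j) \<in> polyspace UNIV 1" for j
      unfolding \<sigma>_def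
      by (cases "j = i")
         (auto intro!: polyspace_diff polyspace_sum polyspace_const polyspace_coord)
    have 1: "(\<lambda>x. \<sigma> (\<theta> x) $ j) \<in> polyspace UNIV 1" for j
      by (rule polyspace_compose[OF \<sigma> \<theta>])
    have 2: "(\<lambda>x. \<psi> (\<sigma> x) $ j) \<in> polyspace UNIV 1" for j
      by (rule polyspace_compose[OF \<psi> \<sigma>])
    have "\<sigma> (\<theta> x) $ i = lam w x" for x
      by (simp add: None lam_def \<sigma>_def \<theta>_def)
    then show ?thesis
      using that[of "\<lambda>x. \<sigma> (\<theta> x)" "\<lambda>x. \<psi> (\<sigma> x)" i] 1 2 by (simp add: affine_hull_W inv \<sigma>\<sigma>)
  qed
qed

end

section \<open>The finite element spaces\<close>

context simplex_frame
begin

text \<open>In this and the next two definitions the index \<open>k\<close> belongs to elements of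
  order \<open>Suc k\<close>, so that the degree \<open>k - 1\<close> of traces and tests becomes
  \<open>k\<close>.\<close>

definition vanishing_on_facet :: "nat \<Rightarrow> 'd option \<Rightarrow> (real^'d \<Rightarrow> real) set" where
  "vanishing_on_facet k w = {a\<in>polyspace UNIV (Suc k). \<forall>x\<in>convex hull (W w). a x = 0}"

definition lower_on_facet :: "nat \<Rightarrow> 'd option \<Rightarrow> (real^'d \<Rightarrow> real) set" where
  "lower_on_facet k w =
    {a\<in>polyspace UNIV (Suc k). \<exists>p\<in>polyspace UNIV k. \<forall>x\<in>convex hull (W w). a x = p x}"

definition facet_restrictions :: "nat \<Rightarrow> 'd option \<Rightarrow> (real^'d \<Rightarrow> real) set" where
  "facet_restrictions k w = {\<lambda>x. if x \<in> convex hull (W w) then p x else 0 | p. p \<in> polyspace UNIV k}"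

lemma hasdim_scalar_spaces:
  "hasdim (vanishing_on_facet k w) (((k + CARD('d)) choose CARD('d)))"
  "hasdim (lower_on_facet k w) (((k + CARD('d)) choose CARD('d)) + ((k + (CARD('d) - 1)) choose (CARD('d) - 1)))"
  "hasdim (facet_restrictions k w) (((k + (CARD('d) - 1)) choose (CARD('d) - 1)))"
proof -
  obtain \<theta> \<psi> :: "real^'d \<Rightarrow> real^'d" and i where
    c: "\<forall>j. (\<lambda>x. \<theta> x $ j) \<in> polyspace UNIV 1" "\<forall>j. (\<lambda>x. \<psi> x $ j) \<in> polyspace UNIV 1"
    "\<forall>x. \<psi> (\<theta> x) = x" "\<forall>x. \<theta> (\<psi> x) = x" "affine hull (W w) = {x. \<theta> x $ i = 0}"
    by (rule facet_chart[of w])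
  note c' = c(1)[rule_format] c(2)[rule_format] c(3)[rule_format] c(4)[rule_format] finite_W c(5)
  show "hasdim (vanishing_on_facet k w) (((k + CARD('d)) choose CARD('d)))"
    unfolding vanishing_on_facet_def by (rule hasdim_vanishing_on_facet[OF c'])
  show "hasdim (lower_on_facet k w) (((k + CARD('d)) choose CARD('d)) + ((k + (CARD('d) - 1)) choose (CARD('d) - 1)))"
    unfolding lower_on_facet_def by (rule hasdim_lower_degree_on_facet[OF c'])
  show "hasdim (facet_restrictions k w) (((k + (CARD('d) - 1)) choose (CARD('d) - 1)))"
    unfolding facet_restrictions_def by (rule hasdim_restricted_to_facet[OF c'])
qed

lemma Sigma_k_iff:
  "\<tau> \<in> Sigma_k k (range vert) \<longleftrightarrow> polyval k \<tau> \<and> (\<forall>x. trace (\<tau> x) = 0) \<and>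
     (\<forall>w. \<exists>p. polyval (k - 1) p \<and> (\<forall>x\<in>convex hull (W w). ntl (N w) (\<tau> x) = p x))"
  by (simp add: Sigma_k_def range_minus_vert polymat_iff_polyval polyvec_iff_polyval nt_eq_ntl N_def)

lemma Bub_iff:
  "\<tau> \<in> Bub k (range vert) \<longleftrightarrow> polyval k \<tau> \<and> (\<forall>x. trace (\<tau> x) = 0) \<and>
     (\<forall>w. \<forall>x\<in>convex hull (W w). ntl (N w) (\<tau> x) = 0)"
proof -
  have 0: "polyval (k - 1) (\<lambda>x::real^'d. 0 :: real^'d)"
    by (simp add: polyval_def polyspace_0)
  have "\<tau> \<in> Bub k (range vert) \<longleftrightarrow> \<tau> \<in> Sigma_k k (range vert) \<and>
     (\<forall>w. \<forall>x\<in>convex hull (W w). ntl (N w) (\<tau> x) = 0)"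
    by (simp add: Bub_def range_minus_vert nt_eq_ntl N_def)
  then show ?thesis unfolding Sigma_k_iff using 0 by blast
qed

lemma trace_sum_MJ: "trace (\<Sum>j\<in>J. c j *\<^sub>R MJ j) = 0"
proof -
  have "trace (\<Sum>j\<in>J. c j *\<^sub>R MJ j) = (\<Sum>j\<in>J. c j * trace (MJ j))"
    by (simp add: linear_sum[OF linear_trace] trace_scaleR)
  also have "\<dots> = 0" by (rule sum.neutral) (auto simp: J_def trace_M)
  finally show ?thesis .
qed

lemma dual_sum:
  assumes "linear \<mu>" "finite K" "v \<in> K" "\<And>u. u \<in> K \<Longrightarrow> \<mu> (e u) = (if v = u then 1 else 0 :: real)"
  shows "\<mu> (\<Sum>u\<in>K. c u *\<^sub>R e u) = c v"
proof -
  have "\<mu> (\<Sum>u\<in>K. c u *\<^sub>R e u) = (\<Sum>u\<in>K. c u * \<mu> (e u))"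
    by (simp add: linear_sum[OF assms(1)] linear_scale[OF assms(1)])
  also have "\<dots> = (\<Sum>u\<in>K. if v = u then c u else 0)"
    by (rule sum.cong) (simp_all add: assms(4))
  also have "\<dots> = c v" using assms(2,3) by simp
  finally show ?thesis .
qed

text \<open>The coefficients of a traceless field are linear functionals of its values, hence
  polynomials of the same degree. On the facet opposite \<open>w\<close> the trace is the
  combination of the \<open>m w v\<close> with precisely the coefficients of index
  \<open>(w, v)\<close>, so a degree bound on the trace is a degree bound on each of them.\<close>

lemma Sigma_k_eq_combos:
  "Sigma_k (Suc k) (range vert) = combos MJ (\<lambda>j. lower_on_facet k (fst j)) J" (is "?L = ?R")
proof (intro equalityI subsetI)
  fix \<tau> assume "\<tau> \<in> ?L"
  then have t: "polyval (Suc k) \<tau>" "\<And>x. trace (\<tau> x) = 0"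
    and p: "\<And>w. \<exists>p. polyval k p \<and> (\<forall>x\<in>convex hull (W w). ntl (N w) (\<tau> x) = p x)"
    by (auto simp: Sigma_k_iff)
  obtain l where l: "\<And>j. linear (l j)" "\<And>X. trace X = 0 \<Longrightarrow> X = (\<Sum>j\<in>J. l j X *\<^sub>R MJ j)"
    using matrix_functionals by blast
  have tx: "\<tau> x = (\<Sum>j\<in>J. l j (\<tau> x) *\<^sub>R MJ j)" for x using l(2)[OF t(2)] .
  have "(\<lambda>x. l j (\<tau> x)) \<in> lower_on_facet k (fst j)" if j: "j \<in> J" for j
  proof -
    obtain w v where wv: "j = (w, v)" "v \<in> Jw w" using j by (auto simp: J_def)
    obtain q where q: "polyval k q" "\<And>x. x \<in> convex hull (W w) \<Longrightarrow> ntl (N w) (\<tau> x) = q x"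
      using p[of w] by blast
    obtain \<mu> where \<mu>: "\<And>v. linear (\<mu> v)"
      "\<And>u v. u \<in> Jw w \<Longrightarrow> v \<in> Jw w \<Longrightarrow> \<mu> u (m w v) = (if u = v then 1 else 0 :: real)"
      using vector_functionals[of w] by blast
    \<comment> \<open>The tangent functional \<open>\<mu> v\<close> recovers the coefficient from
      the trace, so on the facet it equals a polynomial of degree \<open>k\<close>.\<close>
    have "l (w, v) (\<tau> x) = \<mu> v (q x)" if x: "x \<in> convex hull (W w)" for x
    proof -
      have "q x = (\<Sum>u\<in>Jw w. l (w, u) (\<tau> x) *\<^sub>R m w u)"
        using q(2)[OF x] ntl_sum_MJ[of w "\<lambda>j. l j (\<tau> x)"] unfolding tx[of x, symmetric] by simp
      then show ?thesis using dual_sum[OF \<mu>(1) _ wv(2) \<mu>(2)[OF wv(2)]] by simp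
    qed
    moreover have "(\<lambda>x. \<mu> v (q x)) \<in> polyspace UNIV k"
      by (rule polyval_linear[OF q(1) \<mu>(1)])
    moreover have "(\<lambda>x. l (w, v) (\<tau> x)) \<in> polyspace UNIV (Suc k)"
      by (rule polyval_linear[OF t(1) l(1)])
    ultimately show ?thesis unfolding lower_on_facet_def wv(1) by auto
  qed
  then have "(\<lambda>x. \<Sum>j\<in>J. l j (\<tau> x) *\<^sub>R MJ j) \<in> ?R" by (rule combosI)
  moreover have "(\<lambda>x. \<Sum>j\<in>J. l j (\<tau> x) *\<^sub>R MJ j) = \<tau>" by (rule ext) (rule tx[symmetric])
  ultimately show "\<tau> \<in> ?R" by (simp only:)
next
  fix \<tau> assume "\<tau> \<in> ?R"
  then obtain a where a: "\<And>j. j \<in> J \<Longrightarrow> a j \<in> lower_on_facet k (fst j)"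
    and t: "\<tau> = (\<lambda>x. \<Sum>j\<in>J. a j x *\<^sub>R MJ j)" by (rule combosE) blast
  have "\<forall>j\<in>J. \<exists>p\<in>polyspace UNIV k. \<forall>x\<in>convex hull (W (fst j)). a j x = p x"
    using a unfolding lower_on_facet_def by blast
  then obtain p where p: "\<And>j. j \<in> J \<Longrightarrow> p j \<in> polyspace UNIV k"
    "\<And>j x. j \<in> J \<Longrightarrow> x \<in> convex hull (W (fst j)) \<Longrightarrow> a j x = p j x" by metis
  have "polyval (Suc k) \<tau>" unfolding t
    by (rule polyval_combination) (use a in \<open>auto simp: lower_on_facet_def\<close>)
  moreover have "\<forall>x. trace (\<tau> x) = 0" unfolding t by (simp add: trace_sum_MJ)
  moreover have "\<exists>q. polyval k q \<and> (\<forall>x\<in>convex hull (W w). ntl (N w) (\<tau> x) = q x)" for w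
  proof (intro exI conjI ballI)
    show "polyval k (\<lambda>x. \<Sum>v\<in>Jw w. p (w, v) x *\<^sub>R m w v)"
      by (rule polyval_combination) (use p(1) in \<open>auto simp: J_def\<close>)
    fix x assume x: "x \<in> convex hull (W w)"
    show "ntl (N w) (\<tau> x) = (\<Sum>v\<in>Jw w. p (w, v) x *\<^sub>R m w v)"
      unfolding t ntl_sum_MJ by (rule sum.cong) (use p(2) x in \<open>auto simp: J_def\<close>)
  qed
  ultimately show "\<tau> \<in> ?L" by (simp add: Sigma_k_iff)
qed

text \<open>As for \<open>Sigma_k_eq_combos\<close>, with independence of the \<open>m w v\<close>
  in place of the dual functionals: a vanishing trace makes each coefficient vanish on its
  facet.\<close>

lemma Bub_eq_combos:
  "Bub (Suc k) (range vert) = combos MJ (\<lambda>j. vanishing_on_facet k (fst j)) J" (is "?L = ?R")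
proof (intro equalityI subsetI)
  fix \<tau> assume "\<tau> \<in> ?L"
  then have t: "polyval (Suc k) \<tau>" "\<And>x. trace (\<tau> x) = 0"
    and z: "\<And>w x. x\<in>convex hull (W w) \<Longrightarrow> ntl (N w) (\<tau> x) = 0"
    by (auto simp: Bub_iff)
  obtain l where l: "\<And>j. linear (l j)" "\<And>X. trace X = 0 \<Longrightarrow> X = (\<Sum>j\<in>J. l j X *\<^sub>R MJ j)"
    using matrix_functionals by blast
  have tx: "\<tau> x = (\<Sum>j\<in>J. l j (\<tau> x) *\<^sub>R MJ j)" for x using l(2)[OF t(2)] .
  have "(\<lambda>x. l j (\<tau> x)) \<in> vanishing_on_facet k (fst j)" if j: "j \<in> J" for j
  proof -
    obtain w v where wv: "j = (w, v)" "v \<in> Jw w" using j by (auto simp: J_def)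
    have "l (w, v) (\<tau> x) = 0" if x: "x \<in> convex hull (W w)" for x
    proof -
      have "(\<Sum>u\<in>Jw w. l (w, u) (\<tau> x) *\<^sub>R m w u) = 0"
        using z[OF x] ntl_sum_MJ[of w "\<lambda>j. l j (\<tau> x)"] unfolding tx[of x, symmetric] by simp
      then show ?thesis using wv(2) by (rule m_independent)
    qed
    moreover have "(\<lambda>x. l (w, v) (\<tau> x)) \<in> polyspace UNIV (Suc k)"
      by (rule polyval_linear[OF t(1) l(1)])
    ultimately show ?thesis unfolding vanishing_on_facet_def wv(1) by auto
  qed
  then have "(\<lambda>x. \<Sum>j\<in>J. l j (\<tau> x) *\<^sub>R MJ j) \<in> ?R" by (rule combosI)
  moreover have "(\<lambda>x. \<Sum>j\<in>J. l j (\<tau> x) *\<^sub>R MJ j) = \<tau>" by (rule ext) (rule tx[symmetric])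
  ultimately show "\<tau> \<in> ?R" by (simp only:)
next
  fix \<tau> assume "\<tau> \<in> ?R"
  then obtain a where a: "\<And>j. j \<in> J \<Longrightarrow> a j \<in> vanishing_on_facet k (fst j)"
    and t: "\<tau> = (\<lambda>x. \<Sum>j\<in>J. a j x *\<^sub>R MJ j)" by (rule combosE) blast
  have "polyval (Suc k) \<tau>" unfolding t
    by (rule polyval_combination) (use a in \<open>auto simp: vanishing_on_facet_def\<close>)
  moreover have "\<forall>x. trace (\<tau> x) = 0" unfolding t by (simp add: trace_sum_MJ)
  moreover have "ntl (N w) (\<tau> x) = 0" if x: "x \<in> convex hull (W w)" for w x
    unfolding t ntl_sum_MJ
    by (rule sum.neutral) (use a x in \<open>auto simp: J_def vanishing_on_facet_def\<close>)
  ultimately show "\<tau> \<in> ?L" by (simp add: Bub_iff)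
qed

lemma N_inner_m: "N w \<bullet> m w v = 0"
  using N_props(1)[of w] by (simp add: m_def ntl_def inner_diff_right norm_eq_1)

lemma facet_tests_eq_combos:
  "facet_tests (Suc k) (W w) = combos (m w) (\<lambda>_. facet_restrictions k w) (Jw w)" (is "?L = ?R")
proof (intro equalityI subsetI)
  fix f assume "f \<in> ?L"
  then obtain r where f: "f = (\<lambda>x. if x \<in> convex hull (W w) then r x else 0)"
    and r: "polyval k r" "\<And>x. x\<in>convex hull (W w) \<Longrightarrow> r x \<bullet> N w = 0"
    by (auto simp: facet_tests_def N_def polyvec_iff_polyval)
  obtain \<mu> where \<mu>: "\<And>v. linear (\<mu> v)"
    "\<And>r. N w \<bullet> r = 0 \<Longrightarrow> r = (\<Sum>v\<in>Jw w. (\<mu> v r :: real) *\<^sub>R m w v)"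
    using vector_functionals[of w] by blast
  \<comment> \<open>The coefficients are cut off like the tests. Outside the facet \<open>r\<close>
    may have a normal component, and the expansion in tangent vectors would fail.\<close>
  define a where "a = (\<lambda>v x. if x \<in> convex hull (W w) then \<mu> v (r x) else 0)"
  have "(\<lambda>x. \<Sum>v\<in>Jw w. a v x *\<^sub>R m w v) \<in> ?R"
  proof (rule combosI)
    fix v
    have "(\<lambda>x. \<mu> v (r x)) \<in> polyspace UNIV k" by (rule polyval_linear[OF r(1) \<mu>(1)])
    then show "a v \<in> facet_restrictions k w" unfolding facet_restrictions_def a_def mem_Collect_eq
      by (intro exI[of _ "\<lambda>x. \<mu> v (r x)"] conjI refl)
  qed
  moreover have "f x = (\<Sum>v\<in>Jw w. a v x *\<^sub>R m w v)" for x
  proof (cases "x \<in> convex hull (W w)")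
    case True
    then have "N w \<bullet> r x = 0" using r(2) by (simp add: inner_commute)
    from \<mu>(2)[OF this] show ?thesis using True by (simp add: f a_def)
  qed (simp add: f a_def)
  then have "f = (\<lambda>x. \<Sum>v\<in>Jw w. a v x *\<^sub>R m w v)" by (rule ext)
  ultimately show "f \<in> ?R" by simp
next
  fix f assume "f \<in> ?R"
  then obtain a where a: "\<And>v. v \<in> Jw w \<Longrightarrow> a v \<in> facet_restrictions k w"
    and f: "f = (\<lambda>x. \<Sum>v\<in>Jw w. a v x *\<^sub>R m w v)" by (rule combosE) blast
  have "\<forall>v\<in>Jw w. \<exists>p\<in>polyspace UNIV k. a v = (\<lambda>x. if x \<in> convex hull (W w) then p x else 0)"
    using a unfolding facet_restrictions_def by blast
  then obtain p where p: "\<And>v. v \<in> Jw w \<Longrightarrow> p v \<in> polyspace UNIV k"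
    "\<And>v. v \<in> Jw w \<Longrightarrow> a v = (\<lambda>x. if x \<in> convex hull (W w) then p v x else 0)" by metis
  define r where "r = (\<lambda>x. \<Sum>v\<in>Jw w. p v x *\<^sub>R m w v)"
  have "polyval k r" unfolding r_def by (rule polyval_combination) (rule p(1))
  moreover have "r x \<bullet> N w = 0" for x
    by (simp add: r_def inner_commute[of _ "N w"] inner_sum_right N_inner_m)
  moreover have "f = (\<lambda>x. if x \<in> convex hull (W w) then r x else 0)"
    unfolding f r_def by (rule ext) (simp add: p(2))
  ultimately show "f \<in> ?L" unfolding facet_tests_def N_def[symmetric] polyvec_iff_polyval by auto
qed

lemma hasdim_Sigma_k: "hasdim (Sigma_k (Suc k) (range vert)) (card J * (((k + CARD('d)) choose CARD('d)) + ((k + (CARD('d) - 1)) choose (CARD('d) - 1))))"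
  and hasdim_Bub: "hasdim (Bub (Suc k) (range vert)) (card J * ((k + CARD('d)) choose CARD('d)))"
proof -
  obtain l where l: "\<And>j. linear (l j)"
    "\<And>i j. i \<in> J \<Longrightarrow> j \<in> J \<Longrightarrow> l i (MJ j) = (if i = j then 1 else 0 :: real)"
    using matrix_functionals by blast
  have "hasdim (combos MJ (\<lambda>j. lower_on_facet k (fst j)) J) (\<Sum>j\<in>J. ((k + CARD('d)) choose CARD('d)) + ((k + (CARD('d) - 1)) choose (CARD('d) - 1)))"
    by (rule hasdim_combos[OF _ hasdim_scalar_spaces(2) l(1) l(2)]) simp_all
  then show "hasdim (Sigma_k (Suc k) (range vert)) (card J * (((k + CARD('d)) choose CARD('d)) + ((k + (CARD('d) - 1)) choose (CARD('d) - 1))))"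
    by (simp add: Sigma_k_eq_combos)
  have "hasdim (combos MJ (\<lambda>j. vanishing_on_facet k (fst j)) J) (\<Sum>j\<in>J. ((k + CARD('d)) choose CARD('d)))"
    by (rule hasdim_combos[OF _ hasdim_scalar_spaces(1) l(1) l(2)]) simp_all
  then show "hasdim (Bub (Suc k) (range vert)) (card J * ((k + CARD('d)) choose CARD('d)))"
    by (simp add: Bub_eq_combos)
qed

lemma hasdim_facet_tests: "hasdim (facet_tests (Suc k) (W w)) ((CARD('d) - 1) * ((k + (CARD('d) - 1)) choose (CARD('d) - 1)))"
proof -
  obtain \<mu> where \<mu>: "\<And>v. linear (\<mu> v)"
    "\<And>u v. u \<in> Jw w \<Longrightarrow> v \<in> Jw w \<Longrightarrow> \<mu> u (m w v) = (if u = v then 1 else 0 :: real)"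
    using vector_functionals[of w] by blast
  have "hasdim (combos (m w) (\<lambda>_. facet_restrictions k w) (Jw w)) (\<Sum>v\<in>Jw w. ((k + (CARD('d) - 1)) choose (CARD('d) - 1)))"
    by (rule hasdim_combos[OF _ hasdim_scalar_spaces(3) \<mu>(1) \<mu>(2)]) simp_all
  then show ?thesis by (simp add: facet_tests_eq_combos card_Jw)
qed

end

section \<open>Unisolvence\<close>

text \<open>On a box inside the interior the integral lies between 0 and the integral over
  \<open>S\<close>, so the continuous nonnegative \<open>h\<close> vanishes there. A convex body is
  the closure of its interior, which settles the boundary points.\<close>

lemma integral_zero_imp_zero:
  fixes h :: "'a::euclidean_space \<Rightarrow> real"
  assumes S: "convex S" "compact S" "interior S \<noteq> {}" and h: "continuous_on S h"
    and nonneg: "\<And>x. x \<in> S \<Longrightarrow> 0 \<le> h x" and int: "integral S h = 0" and x: "x \<in> S"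
  shows "h x = 0"
proof -
  have SI: "closure (interior S) = S"
    using convex_closure_interior[OF S(1,3)] S(2) by (simp add: compact_imp_closed)
  have hS: "h integrable_on S"
    by (rule set_borel_integral_eq_integral(1)[OF borel_integrable_compact[OF S(2) h, folded set_integrable_def]])
  have zero: "h y = 0" if y: "y \<in> interior S" for y
  proof -
    obtain a b where ab: "cbox a b \<subseteq> interior S" "y \<in> box a b" "\<forall>i\<in>Basis. a \<bullet> i < b \<bullet> i"
      by (rule open_contains_cbox[OF open_interior y])
    have sub: "cbox a b \<subseteq> S" using ab(1) interior_subset by blast
    have c: "continuous_on (cbox a b) h" using h sub continuous_on_subset by blast
    then have hi: "h integrable_on cbox a b" by (rule integrable_continuous)
    have "integral (cbox a b) h \<le> integral S h"
      by (rule integral_subset_le[OF sub hi hS]) (use nonneg in auto)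
    moreover have "0 \<le> integral (cbox a b) h"
      by (rule integral_nonneg[OF hi]) (use nonneg sub in auto)
    ultimately have "integral (cbox a b) h = 0" using int by simp
    then have "(h has_integral 0) (cbox a b)" using integrable_integral[OF hi] by simp
    moreover have "0 \<le> h x" if "x \<in> box a b" for x
      using that nonneg sub box_subset_cbox[of a b] by blast
    moreover have "box a b \<noteq> {}" "y \<in> cbox a b" using ab(2) box_subset_cbox by blast+
    ultimately show ?thesis using has_integral_0_cbox_imp_0[OF c] by blast
  qed
  show ?thesis
    using continuous_constant_on_closure[of "interior S" h 0 x] h zero x unfolding SI by simp
qed

section \<open>Reference simplex, affine images and the Frobenius product\<close>

lemma ref_vertices_eq: "ref_vertices = insert 0 (Basis :: (real^'d) set)"
  by (auto simp: ref_vertices_def Basis_vec_def)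

lemma ref_simplex_eq: "ref_simplex = convex hull (ref_vertices :: (real^'e) set)"
proof -
  have B: "Basis = range (\<lambda>i. axis i 1 :: real^'e)" by (auto simp: Basis_vec_def)
  have inj: "inj (\<lambda>i. axis i 1 :: real^'e)" by (auto simp: inj_def axis_eq_axis)
  show ?thesis
    unfolding ref_vertices_eq std_simplex ref_simplex_def
    by (simp add: B sum.reindex[OF inj] inner_axis)
qed

lemma affine_image_hull:
  fixes X :: "real^'e^'d"
  shows "(\<lambda>y. X *v y + c) ` (convex hull S) = convex hull ((\<lambda>y. X *v y + c) ` S)"
proof -
  have "convex hull ((\<lambda>y. X *v y + c) ` S) = convex hull ((\<lambda>x. c + x) ` ((*v) X ` S))"
    by (simp add: image_image add.commute)
  also have "\<dots> = (\<lambda>x. c + x) ` (convex hull ((*v) X ` S))" by (rule convex_hull_translation)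
  also have "convex hull ((*v) X ` S) = (*v) X ` (convex hull S)"
    by (rule convex_hull_linear_image[symmetric]) simp
  finally show ?thesis by (simp add: image_image add.commute)
qed

lemma frob_eq_inner: "frob X Y = X \<bullet> Y"
  by (simp add: frob_def inner_vec_def)

lemma frob_eq_trace: "frob X Y = trace (transpose X ** Y)"
  unfolding frob_def trace_def transpose_def matrix_matrix_mult_def
  by (simp, rule sum.swap)

text \<open>By cyclicity of the trace, \<open>X \<mapsto> transpose A ** X ** transpose B\<close> is
  the Frobenius adjoint of \<open>\<eta> \<mapsto> A ** \<eta> ** B\<close>. Testing
  \<open>X\<close> against the push-forward of its own pull-back therefore gives a squared
  norm.\<close>

lemma frob_similarity:
  fixes A B X :: "real^'d^'d"
  assumes AB: "A ** B = mat 1" "B ** A = mat 1"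
  defines "\<eta> \<equiv> transpose A ** X ** transpose B"
  shows "frob X (A ** \<eta> ** B) = frob \<eta> \<eta>"
proof -
  have t: "transpose \<eta> = B ** transpose X ** A"
    by (simp add: \<eta>_def matrix_transpose_mul matrix_mul_assoc)
  have "frob X (A ** \<eta> ** B) = trace ((transpose X ** A ** \<eta>) ** B)"
    by (simp add: frob_eq_trace matrix_mul_assoc)
  also have "\<dots> = trace (B ** (transpose X ** A ** \<eta>))" by (rule trace_mul_sym)
  also have "\<dots> = trace (transpose \<eta> ** \<eta>)" by (simp add: t matrix_mul_assoc)
  finally show ?thesis by (simp add: frob_eq_trace)
qed

lemma linear_matrix_sandwich: "linear (\<lambda>X. P ** X ** (R :: real^'d^'d))"
proof (rule linearI)
  show "P ** (X + Y) ** R = P ** X ** R + P ** Y ** R" for X Y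
    by (simp add: vec_eq_iff matrix_matrix_mult_def distrib_left distrib_right sum.distrib)
  show "P ** (c *\<^sub>R X) ** R = c *\<^sub>R (P ** X ** R)" for c X
    by (simp add: vec_eq_iff matrix_matrix_mult_def mult.assoc mult.left_commute flip: sum_distrib_left)
qed

context simplex_frame
begin

lemma range_vert: "range vert = (\<lambda>y. A *v y + b) ` ref_vertices"
  by (auto simp: UNIV_option_conv vert_def ref_vertices_def image_iff add.commute)

lemma affine_independent_vert: "\<not> affine_dependent (range vert)"
proof
  assume "affine_dependent (range vert)"
  then obtain w where "vert w \<in> affine hull (range vert - {vert w})"
    unfolding affine_dependent_def by blast
  then show False by (simp add: range_minus_vert affine_hull_W lam_vert)
qed

lemma card_range_vert: "card (range vert) = Suc (CARD('d))"
  by (simp add: card_image inj_vert card_UNIV_option)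

lemma affine_hull_vert: "affine hull (range vert) = UNIV"
  by (rule affine_independent_span_eq) (simp_all add: affine_independent_vert card_range_vert)

lemma interior_hull_vert: "interior (convex hull (range vert)) \<noteq> {}"
  using interior_convex_hull_eq_empty[of "range vert"] affine_independent_vert card_range_vert by simp

text \<open>Vertices are the extreme points of the hull. This is needed because the affine bijection
  is given on hulls, whereas spaces and functionals are indexed by vertices.\<close>

lemma vertices_determined_by_hull:
  assumes "\<not> affine_dependent V" "convex hull V = convex hull (range vert)"
  shows "V = range vert"
  using extreme_point_of_convex_hull_affine_independent[OF assms(1)]
    extreme_point_of_convex_hull_affine_independent[OF affine_independent_vert] assms(2)
  by auto

text \<open>\<open>facet_integral\<close> is a choice, so its value is only known to come from some
  affine parametrisation. One exists because the facet has \<open>CARD('e)\<close> vertices besides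
  the base vertex.\<close>

lemma facet_parametrisation:
  assumes "CARD('d) = CARD('e::finite) + 1"
  obtains w0 and p :: "'e::finite \<Rightarrow> real^'d" where
    "w0 \<in> W w" "inj p" "w0 \<notin> range p" "W w = insert w0 (range p)"
    "facet_integral TYPE('e) (W w) h = integral (ref_simplex :: (real^'e) set)
       (\<lambda>s. h (w0 + (\<chi> i j. (p j - w0) $ i) *v s) *
         sqrt (det (transpose (\<chi> i j. (p j - w0) $ i) ** (\<chi> i j. (p j - w0) $ i :: real^'e^'d))))"
proof -
  let ?P = "\<lambda>I. \<exists>w0 (p :: 'e::finite \<Rightarrow> real^'d).
      w0 \<in> W w \<and> inj p \<and> w0 \<notin> range p \<and> W w = insert w0 (range p) \<and>
      (let J = (\<chi> i j. (p j - w0) $ i) :: real^'e^'d in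
       I = integral (ref_simplex :: (real^'e) set)
             (\<lambda>s. h (w0 + J *v s) * sqrt (det (transpose J ** J))))"
  have "card (W w) = CARD('d)"
    unfolding W_def using inj_vert
    by (subst card_image) (auto intro: inj_on_subset simp: Compl_eq_Diff_UNIV card_UNIV_option)
  moreover have w0: "vert (other w) \<in> W w" using other_neq by (auto simp: W_def)
  ultimately have "card (W w - {vert (other w)}) = CARD('e)"
    using assms by simp
  then obtain p :: "'e::finite \<Rightarrow> real^'d" where "bij_betw p UNIV (W w - {vert (other w)})"
    using finite_same_card_bij[of "UNIV :: 'e set" "W w - {vert (other w)}"] finite_W by auto
  then have p: "inj p" "range p = W w - {vert (other w)}"
    by (auto simp: bij_betw_def)
  have "\<exists>I. ?P I"
    by (rule exI, rule exI[of _ "vert (other w)"], rule exI[of _ p])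
       (use p w0 in \<open>auto simp: Let_def\<close>)
  then have "?P (SOME I. ?P I)" by (rule someI_ex)
  then have "?P (facet_integral TYPE('e) (W w) h)" unfolding facet_integral_def .
  then show ?thesis using that unfolding Let_def by blast
qed

text \<open>The edges \<open>p j - w0\<close> are independent, so the Gram determinant is nonzero
  and the surface element is a nonzero constant factor. Without it the integral is a volume integral
  over the reference simplex.\<close>

lemma zero_if_facet_integral_zero:
  fixes h :: "real^'d \<Rightarrow> real"
  assumes card: "CARD('d) = CARD('e::finite) + 1" and h: "continuous_on (convex hull (W w)) h"
    and nonneg: "\<And>x. x \<in> convex hull (W w) \<Longrightarrow> 0 \<le> h x"
    and zero: "facet_integral TYPE('e) (W w) h = 0" and x: "x \<in> convex hull (W w)"
  shows "h x = 0"
proof -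
  obtain w0 and p :: "'e::finite \<Rightarrow> real^'d" where
    w0: "w0 \<in> W w" and p: "inj p" "w0 \<notin> range p" "W w = insert w0 (range p)" and
    int: "facet_integral TYPE('e) (W w) h = integral (ref_simplex :: (real^'e) set)
       (\<lambda>s. h (w0 + (\<chi> i j. (p j - w0) $ i) *v s) *
         sqrt (det (transpose (\<chi> i j. (p j - w0) $ i) ** (\<chi> i j. (p j - w0) $ i :: real^'e^'d))))"
    by (rule facet_parametrisation[OF card, of w h])
  define K :: "real^'e^'d" where "K = (\<chi> i j. (p j - w0) $ i)"
  have Kaxis: "K *v axis j 1 = p j - w0" for j
    by (simp add: matrix_vector_mult_basis K_def column_def vec_eq_iff)
  have Kzero: "s = 0" if s: "K *v s = 0" for s
  proof -
    have Ks: "K *v s = (\<Sum>j\<in>UNIV. s $ j *\<^sub>R (p j - w0))"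
      by (subst matrix_mult_sum) (simp add: Kaxis[symmetric] matrix_vector_mult_basis scalar_mult_eq_scaleR)
    have "s $ l = 0" for l
    proof -
      have "p l \<in> W w" using p(3) by simp
      then obtain q u where q: "p l = vert q" "w0 = vert u" using w0 unfolding W_def by blast
      \<comment> \<open>The gradient belonging to the vertex \<open>p l\<close> sees only the edge
        from \<open>w0\<close> to \<open>p l\<close>, and so extracts \<open>s $ l\<close>.\<close>
      have "g q \<bullet> (p j - w0) = (if j = l then 1 else 0)" for j
      proof -
        have "p j \<in> W w" using p(3) by simp
        then obtain t where t: "p j = vert t" unfolding W_def by blast
        have "t = q \<longleftrightarrow> j = l" using t q inj_vert p(1) by (auto simp: inj_def)
        moreover have "u \<noteq> q" using q p(2) by (metis rangeI)
        ultimately show ?thesis by (simp add: t q g_vert)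
      qed
      then have "g q \<bullet> (K *v s) = s $ l"
        by (simp add: Ks inner_sum_right if_distrib[where f = "\<lambda>t. _ * t"] cong: if_cong)
      then show ?thesis using s by simp
    qed
    then show ?thesis by (simp add: vec_eq_iff)
  qed
  have "s = 0" if "(transpose K ** K) *v s = 0" for s
  proof -
    have "(K *v s) \<bullet> (K *v s) = s \<bullet> ((transpose K ** K) *v s)"
      by (simp add: dot_lmul_matrix[symmetric] matrix_vector_mul_assoc[symmetric] inner_commute)
    then show ?thesis using that Kzero by simp
  qed
  then have "invertible (transpose K ** K)"
    unfolding invertible_left_inverse matrix_left_invertible_ker by blast
  then have det: "sqrt (det (transpose K ** K)) \<noteq> 0" by (simp add: invertible_det_nz)
  have im: "(\<lambda>s. K *v s + w0) ` ref_simplex = convex hull (W w)"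
  proof -
    have "(\<lambda>s. K *v s + w0) ` ref_vertices = W w"
      unfolding p(3) ref_vertices_def by (simp add: image_insert image_image Kaxis)
    then show ?thesis unfolding ref_simplex_eq affine_image_hull by simp
  qed
  have hull: "w0 + K *v s \<in> convex hull (W w)" if "s \<in> ref_simplex" for s
    using that im by (auto simp: add.commute)
  have "integral ref_simplex (\<lambda>s. h (w0 + K *v s)) * sqrt (det (transpose K ** K)) = 0"
    using int zero unfolding K_def[symmetric] by simp
  then have int0: "integral ref_simplex (\<lambda>s. h (w0 + K *v s)) = 0" using det by simp
  have fin: "finite (ref_vertices :: (real^'e) set)" by (simp add: ref_vertices_def)
  have ne: "interior (ref_simplex :: (real^'e) set) \<noteq> {}"
    unfolding ref_simplex_eq ref_vertices_eq using interior_std_simplex_nonempty by blast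
  have "continuous_on ref_simplex (\<lambda>s. w0 + K *v s)"
    by (intro continuous_intros matrix_vector_mult_linear_continuous_on)
  then have cont: "continuous_on ref_simplex (\<lambda>s. h (w0 + K *v s))"
    by (rule continuous_on_compose2[OF h]) (use hull in auto)
  obtain s where s: "s \<in> ref_simplex" "x = w0 + K *v s" using x im by (auto simp: add.commute)
  have "h (w0 + K *v s) = 0"
    by (rule integral_zero_imp_zero[OF _ _ ne cont _ int0 s(1)])
       (use hull nonneg fin in \<open>auto simp: ref_simplex_eq intro: compact_convex_hull finite_imp_compact\<close>)
  then show ?thesis by (simp add: s(2))
qed

text \<open>Gradients on the two simplices satisfy \<open>transpose B *v R.g v = g v\<close>, so
  conjugation by \<open>transpose A\<close> turns the eigenvector \<open>g w\<close> into
  \<open>R.g w\<close>. The eigenvector form of a zero trace avoids comparing normals that are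
  chosen separately on the two simplices.\<close>

lemma pullback_Bub:
  assumes "\<tau> \<in> Bub k (range vert)"
  shows "(\<lambda>y. transpose A ** \<tau> (A *v y + b) ** transpose B) \<in> Bub k ref_vertices"
proof -
  interpret R: simplex_frame "mat 1" "mat 1" "0 :: real^'d" by unfold_locales simp_all
  let ?\<eta> = "\<lambda>y. transpose A ** \<tau> (A *v y + b) ** transpose B"
  have BtAt: "transpose B ** transpose A = mat 1" "transpose A ** transpose B = mat 1"
    by (simp_all add: matrix_transpose_mul[symmetric] AB BA)
  have t: "polyval k \<tau>" "\<And>x. trace (\<tau> x) = 0" "\<And>w x. x\<in>convex hull (W w) \<Longrightarrow> ntl (N w) (\<tau> x) = 0"
    using assms by (auto simp: Bub_iff)
  have ref: "range R.vert = ref_vertices" by (simp add: R.range_vert)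
  have gg: "transpose B *v R.g v = g v" for v
  proof -
    have row: "transpose B *v (mat 1 $ i) = B $ i" for i
      by (simp add: vec_eq_iff matrix_vector_mult_def transpose_def mat_def if_distrib[where f = "\<lambda>t. _ * t"] cong: if_cong)
    show ?thesis
    proof (cases v)
      case None
      have "transpose B *v (\<Sum>i\<in>UNIV. mat 1 $ i) = (\<Sum>i\<in>UNIV. B $ i)"
        by (simp only: linear_sum[OF matrix_vector_mul_linear] row)
      then show ?thesis using None by (simp only: g_def R.g_def option.case linear_neg[OF matrix_vector_mul_linear])
    qed (simp only: g_def R.g_def option.case row)
  qed
  have WW: "(\<lambda>y. A *v y + b) ` R.W w = W w" for w
  proof -
    have "A *v R.vert v + b = vert v" for v
      by (cases v) (simp_all add: vert_def R.vert_def)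
    then show ?thesis by (simp add: W_def R.W_def image_image)
  qed
  have "polyval k (\<lambda>y. \<tau> (A *v y + b))"
    by (rule polyval_compose[OF t(1) polyspace_affine])
  from polyval_linear_image[OF this linear_matrix_sandwich[of "transpose A" "transpose B"]]
  have "polyval k ?\<eta>" .
  moreover have "trace (?\<eta> y) = 0" for y
  proof -
    have "trace (?\<eta> y) = trace (transpose B ** (transpose A ** \<tau> (A *v y + b)))" by (rule trace_mul_sym)
    then show ?thesis by (simp add: matrix_mul_assoc BtAt t(2))
  qed
  moreover have "ntl (R.N w) (?\<eta> y) = 0" if y: "y \<in> convex hull (R.W w)" for w y
  proof -
    have "A *v y + b \<in> convex hull (W w)"
      using imageI[OF y, of "\<lambda>y. A *v y + b"] unfolding affine_image_hull WW .
    then obtain c where c: "\<tau> (A *v y + b) *v g w = c *\<^sub>R g w"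
      using t(3) ntl_zero_iff by blast
    have "?\<eta> y *v R.g w = transpose A *v (\<tau> (A *v y + b) *v (transpose B *v R.g w))"
      by (simp only: matrix_vector_mul_assoc matrix_mul_assoc)
    also have "\<dots> = c *\<^sub>R (transpose A *v (transpose B *v R.g w))"
      by (simp only: gg c matrix_vector_mult_scaleR)
    also have "\<dots> = c *\<^sub>R R.g w"
      by (simp only: matrix_vector_mul_assoc BtAt matrix_vector_mul_lid)
    finally show ?thesis unfolding R.ntl_zero_iff by blast
  qed
  ultimately show ?thesis unfolding ref[symmetric] R.Bub_iff by blast
qed

lemma unisolvent:
  assumes card: "CARD('d) = CARD('e::finite) + 1" and B: "B = matrix_inv A"
    and \<tau>: "\<tau> \<in> Sigma_k (Suc k) (range vert)"
    and dofs: "\<forall>\<phi>\<in>Phi TYPE('e) (Suc k) (range vert) A b. \<phi> \<tau> = 0"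
  shows "\<tau> = (\<lambda>x. 0)"
proof -
  have t: "polyval (Suc k) \<tau>" "\<And>x. trace (\<tau> x) = 0"
    and tp: "\<And>w. \<exists>p. polyval k p \<and> (\<forall>x\<in>convex hull (W w). ntl (N w) (\<tau> x) = p x)"
    using \<tau> unfolding Sigma_k_iff diff_Suc_1 by blast+
  have nt0: "ntl (N w) (\<tau> x) = 0" if x: "x \<in> convex hull (W w)" for w x
  proof -
    obtain p where p: "polyval k p" "\<And>x. x \<in> convex hull (W w) \<Longrightarrow> ntl (N w) (\<tau> x) = p x"
      using tp[of w] by blast
    \<comment> \<open>The trace is tangential and of degree \<open>k\<close> on the facet, hence an
      admissible test for itself; its functional integrates
      \<open>p x \<bullet> p x\<close>.\<close>
    define r where "r = (\<lambda>x. if x \<in> convex hull (W w) then p x else 0)"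
    have "p x \<bullet> N w = 0" if "x \<in> convex hull (W w)" for x
      unfolding p(2)[OF that, symmetric] ntl_def
      using N_props(1)[of w] by (simp add: inner_diff_left inner_diff_right norm_eq_1 inner_commute)
    then have "r \<in> facet_tests (Suc k) (W w)"
      unfolding facet_tests_def N_def[symmetric] r_def polyvec_iff_polyval using p(1) by auto
    then have "(\<lambda>\<tau>. facet_integral TYPE('e) (W w) (\<lambda>x. nt \<tau> (facet_normal (W w)) x \<bullet> r x))
        \<in> Phi TYPE('e) (Suc k) (range vert) A b"
      unfolding Phi_def Phi_facet_def by (auto simp: range_minus_vert)
    from bspec[OF dofs this]
    have int: "facet_integral TYPE('e) (W w) (\<lambda>x. ntl (N w) (\<tau> x) \<bullet> r x) = 0"
      by (simp add: nt_eq_ntl N_def)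
    have eq: "ntl (N w) (\<tau> x) \<bullet> r x = p x \<bullet> p x" if "x \<in> convex hull (W w)" for x
      using that p(2) by (simp add: r_def)
    have "continuous_on (convex hull (W w)) (\<lambda>x. p x \<bullet> p x)"
      by (intro continuous_intros polyval_continuous[OF p(1)])
    then have "continuous_on (convex hull (W w)) (\<lambda>x. ntl (N w) (\<tau> x) \<bullet> r x)"
      by (rule continuous_on_eq) (simp add: eq)
    then have "ntl (N w) (\<tau> x) \<bullet> r x = 0"
      by (rule zero_if_facet_integral_zero[OF card _ _ int x]) (simp add: eq)
    then show ?thesis using p(2)[OF x] eq[OF x] by simp
  qed
  then have "\<tau> \<in> Bub (Suc k) (range vert)" using t by (simp add: Bub_iff)
  note pb = pullback_Bub[OF this]
  define \<eta> where "\<eta> = (\<lambda>x. transpose A ** \<tau> x ** transpose B)"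
  \<comment> \<open>The interior functional whose test is the pull-back of \<open>\<tau>\<close>
    itself. The inner argument \<open>A *v (B *v (x - b)) + b\<close> reduces to
    \<open>x\<close>.\<close>
  have "(\<lambda>\<sigma>. integral (convex hull (range vert))
      (\<lambda>x. frob (\<sigma> x) (A ** (transpose A ** \<tau> (A *v (B *v (x - b)) + b) ** transpose B) ** B)))
      \<in> Phi TYPE('e) (Suc k) (range vert) A b"
    unfolding Phi_def Phi_int_def B[symmetric]
    by (intro UnI1 CollectI exI[of _ "\<lambda>y. transpose A ** \<tau> (A *v y + b) ** transpose B"] conjI pb refl)
  from bspec[OF dofs this]
  have "integral (convex hull (range vert)) (\<lambda>x. frob (\<tau> x) (A ** \<eta> x ** B)) = 0"
    by (simp add: A_B_vec \<eta>_def)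
  then have int: "integral (convex hull (range vert)) (\<lambda>x. \<eta> x \<bullet> \<eta> x) = 0"
    unfolding \<eta>_def frob_similarity[OF AB BA] unfolding frob_eq_inner .
  have "polyval (Suc k) \<eta>"
    unfolding \<eta>_def by (rule polyval_linear_image[OF t(1) linear_matrix_sandwich])
  then have cont: "continuous_on (convex hull (range vert)) (\<lambda>x. \<eta> x \<bullet> \<eta> x)"
    by (intro continuous_intros polyval_continuous)
  have "\<tau> x = 0" if x: "x \<in> convex hull (range vert)" for x
  proof -
    have "\<eta> x \<bullet> \<eta> x = 0"
      by (rule integral_zero_imp_zero[OF _ _ interior_hull_vert cont _ int x])
         (simp_all add: finite_imp_compact_convex_hull)
    then have "\<eta> x = 0" by simp
    moreover have "transpose B ** \<eta> x ** transpose A = (transpose B ** transpose A) ** \<tau> x ** (transpose B ** transpose A)"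
      by (simp add: \<eta>_def matrix_mul_assoc)
    then have "transpose B ** \<eta> x ** transpose A = \<tau> x"
      by (simp add: matrix_transpose_mul[symmetric] AB)
    ultimately show ?thesis by simp
  qed
  \<comment> \<open>Elements of \<open>Sigma_k\<close> live on the whole space; a polynomial field
    vanishing on the simplex vanishes on its affine hull, which is everything.\<close>
  then have "\<tau> x = 0" for x
    using polyval_zero_on_affine_hull[OF t(1), of "range vert" x] by (simp add: affine_hull_vert)
  then show ?thesis by (rule ext)
qed

end

section \<open>Closed dimension formulas and the final assembly\<close>

lemma choose_two_real: "real ((k + 2) choose 2) = (real k + 1) * (real k + 2) / 2"
  by (induction k) (simp_all add: numeral_eq_Suc field_simps)

lemma choose_three_real: "real ((k + 3) choose 3) = (real k + 1) * (real k + 2) * (real k + 3) / 6"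
proof (induction k)
  case (Suc k)
  have "Suc k + 3 choose 3 = (k + 3 choose 3) + (Suc k + 2 choose 2)"
    by (simp add: numeral_eq_Suc)
  then have "real (Suc k + 3 choose 3) = real (k + 3 choose 3) + real (Suc k + 2 choose 2)" by simp
  then show ?case unfolding Suc.IH choose_two_real by (simp add: field_simps)
qed simp

theorem theorem5p4:
  fixes V :: "(real^'d) set" and A :: "real^'d^'d" and b :: "real^'d" and k :: nat
  assumes "CARD('d) = 2 \<or> CARD('d) = 3"
    and "CARD('d) = CARD('e::finite) + 1"
    and "nondeg_simplex V"
    and "k \<ge> 1"
    and "invertible A"
    and "(\<lambda>x. A *v x + b) ` (convex hull (ref_vertices :: (real^'d) set)) = convex hull V"
  shows "(\<forall>\<tau>\<in>Sigma_k k V. (\<forall>\<phi>\<in>Phi TYPE('e) k V A b. \<phi> \<tau> = 0) \<longrightarrow> \<tau> = (\<lambda>x. 0))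
    \<and> num_dofs k V = fdim (Sigma_k k V)
    \<and> real (fdim (Sigma_k k V)) =
        (if CARD('d) = 2 then 3 / 2 * (real k + 1) * (real k + 2) - 3
         else 8 / 6 * (real k + 1) * (real k + 2) * (real k + 3) - 8 * (real k + 1))"
proof -
  have "A ** matrix_inv A = mat 1 \<and> matrix_inv A ** A = mat 1"
    unfolding matrix_inv_def by (rule someI_ex) (use assms(5) in \<open>simp add: invertible_def\<close>)
  then interpret T: simplex_frame A "matrix_inv A" b
    by unfold_locales auto
  \<comment> \<open>The frame \<open>T\<close> describes the given simplex, \<open>R\<close> the
    reference simplex on which the interior tests live.\<close>
  interpret R: simplex_frame "mat 1" "mat 1" "0 :: real^'d" by unfold_locales simp_all
  obtain j where k: "k = Suc j" using assms(4) by (cases k) auto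
  have V: "V = range T.vert"
    by (rule T.vertices_determined_by_hull)
       (use assms(3,6) in \<open>simp_all add: nondeg_simplex_def T.range_vert affine_image_hull\<close>)
  have ref: "range R.vert = ref_vertices" by (simp add: R.range_vert)
  \<comment> \<open>Contributions per basis matrix: \<open>?m\<close> for the bubble part and
    \<open>?n\<close> for the polynomials of degree \<open>j\<close> on the facet.\<close>
  let ?m = "(j + CARD('d)) choose CARD('d)" and ?n = "(j + (CARD('d) - 1)) choose (CARD('d) - 1)"
  have S: "fdim (Sigma_k k V) = (CARD('d) + 1) * (CARD('d) - 1) * (?m + ?n)"
    using fdim_eq_if_hasdim[OF T.hasdim_Sigma_k[of j]] by (simp add: V k T.card_J)
  have Bb: "fdim (Bub k (ref_vertices :: (real^'d) set)) = (CARD('d) + 1) * (CARD('d) - 1) * ?m"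
    using fdim_eq_if_hasdim[OF R.hasdim_Bub[of j]] by (simp add: ref k R.card_J)
  have "(\<Sum>w\<in>V. fdim (facet_tests k (V - {w}))) = (\<Sum>w\<in>UNIV. fdim (facet_tests k (T.W w)))"
    unfolding V by (simp add: sum.reindex[OF T.inj_vert] T.range_minus_vert)
  also have "\<dots> = (CARD('d) + 1) * ((CARD('d) - 1) * ?n)"
    by (simp add: k fdim_eq_if_hasdim[OF T.hasdim_facet_tests] card_UNIV_option)
  finally have nd: "num_dofs k V = fdim (Sigma_k k V)"
    unfolding num_dofs_def Bb S by (simp add: algebra_simps)
  have dim: "real (fdim (Sigma_k k V)) =
        (if CARD('d) = 2 then 3 / 2 * (real k + 1) * (real k + 2) - 3
         else 8 / 6 * (real k + 1) * (real k + 2) * (real k + 3) - 8 * (real k + 1))"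
  proof (cases "CARD('d) = 2")
    case True
    have "real (fdim (Sigma_k k V)) = 3 * (real ((j + 2) choose 2) + real (j + 1))"
      unfolding S True by simp
    then show ?thesis unfolding choose_two_real using True by (simp add: k field_simps)
  next
    case False
    then have d: "CARD('d) = 3" using assms(1) by simp
    have "real (fdim (Sigma_k k V)) = 8 * (real ((j + 3) choose 3) + real ((j + 2) choose 2))"
      unfolding S d by simp
    then show ?thesis unfolding choose_two_real choose_three_real using False by (simp add: k field_simps)
  qed
  show ?thesis
    using T.unisolvent[OF assms(2) refl] nd dim unfolding V k by blast
qed

end
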